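(* For every $f\in L^2(\mathbb{S}^1)$, $$\|\widehat{f\sigma}\|_{L^6_{\mathrm{rad}}L^2_{\mathrm{ang}}(\mathbb{R}^2)}^6\le I(0,0,0)\,\|f\|_{L^2(\mathbb{S}^1)}^6,\qquad I(0,0,0)=\int_0^\infty J_0(r)^6\, r\,\mathrm{d}r.$$ This inequality is sharp, with constants being the unique extremizers.
   Context: $\mathbb{S}^1=\{\omega\in\mathbb{R}^2: |\omega|=1\}$ is the unit circle, $\sigma$ is its arc length measure (total mass $2\pi$), and $\|f\|_{L^2(\mathbb{S}^1)}^2=\int_{\mathbb{S}^1}|f|^2\,\mathrm{d}\sigma$. The extension operator is taken with the normalization $$\widehat{f\sigma}(x)=\frac{1}{2\pi}\int_{\mathbb{S}^1} f(\omega)e^{-ix\cdot\omega}\,\mathrm{d}\sigma_\omega,\qquad x\in\mathbb{R}^2,$$ so that, for every spherical harmonic $Y_k$ of degree $k\ge 0$ on $\mathbb{S}^1$, one has $|\widehat{Y_k\sigma}(x)|=|J_k(|x|)|\,|Y_k(x/|x|)|$ for $x\neq 0$. Here $J_k$ is the Bessel function of the first kind of order $k$. The mixed norm is $$\|\widehat{f\sigma}\|_{L^6_{\mathrm{rad}}L^2_{\mathrm{ang}}(\mathbb{R}^2)}=\left(\int_0^\infty\left(\int_{\mathbb{S}^1}|\widehat{f\sigma}(r\omega)|^2\,\mathrm{d}\sigma_\omega\right)^{3} r\,\mathrm{d}r\right)^{1/6}.$$ An extremizer is a nonzero $f\in L^2(\mathbb{S}^1)$ for which equality holds (functions being identified when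 equal $\sigma$-almost everywhere). *)

theory Defs
  imports "HOL-Analysis.Analysis"
begin

type_synonym plane = "real ^ 2"

definition circle_point :: "real \<Rightarrow> plane" where
  "circle_point t = vector [cos t, sin t]"

(* Arc length: the push-forward of Lebesgue measure under the unit-speed parametrization. *)
definition arc_length :: "plane measure" where
  "arc_length =
     distr (restrict_space lborel {0..<2 * pi}) (restrict_space borel (sphere 0 1)) circle_point"

definition L2_circle :: "(plane \<Rightarrow> complex) set" where
  "L2_circle = {f \<in> borel_measurable arc_length. integrable arc_length (\<lambda>\<omega>. (cmod (f \<omega>))\<^sup>2)}"

definition L2_circle_norm :: "(plane \<Rightarrow> complex) \<Rightarrow> real" where
  "L2_circle_norm f = sqrt (\<integral>\<omega>. (cmod (f \<omega>))\<^sup>2 \<partial>arc_length)"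

definition extension :: "(plane \<Rightarrow> complex) \<Rightarrow> plane \<Rightarrow> complex" where
  "extension f x =
     1 / (2 * pi) * (\<integral>\<omega>. f \<omega> * exp (- \<i> * complex_of_real (x \<bullet> \<omega>)) \<partial>arc_length)"

definition ennreal_root :: "nat \<Rightarrow> ennreal \<Rightarrow> ennreal" where
  "ennreal_root n a = (if a = \<infinity> then \<infinity> else ennreal (root n (enn2real a)))"

(* Integrals with values in [0,\<infinity>], so that a divergent integral has norm \<infinity> and not 0. *)
definition mixed_norm :: "(plane \<Rightarrow> complex) \<Rightarrow> ennreal" where
  "mixed_norm F =
     ennreal_root 6
       (\<integral>\<^sup>+ r \<in> {0..}. (\<integral>\<^sup>+ \<omega>. ennreal ((cmod (F (r *\<^sub>R \<omega>)))\<^sup>2) \<partial>arc_length) ^ 3 * ennreal r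
        \<partial>lborel)"

definition bessel_J :: "nat \<Rightarrow> real \<Rightarrow> real" where
  "bessel_J k x = (\<Sum>m. (- 1) ^ m / (fact m * fact (m + k)) * (x / 2) ^ (2 * m + k))"

definition I000 :: real where
  "I000 = (LBINT r:{0..}. bessel_J 0 r ^ 6 * r)"

definition extremizer :: "(plane \<Rightarrow> complex) \<Rightarrow> bool" where
  "extremizer f \<longleftrightarrow>
     f \<in> L2_circle \<and> \<not> (AE \<omega> in arc_length. f \<omega> = 0) \<and>
     mixed_norm (extension f) ^ 6 = ennreal (I000 * L2_circle_norm f ^ 6)"

lemma circle_point_measurable:
  "circle_point \<in> restrict_space lborel {0..<2 * pi} \<rightarrow>\<^sub>M restrict_space borel (sphere 0 1)"
proof (rule measurable_restrict_space2)
  show "circle_point \<in> space (restrict_space lborel {0..<2 * pi}) \<rightarrow> sphere 0 1"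
    by (auto simp: circle_point_def norm_vec_def L2_set_def sum_2 vector_2)
  have "circle_point = (\<lambda>t. cos t *\<^sub>R axis 1 1 + sin t *\<^sub>R axis 2 1)"
    by (auto simp: fun_eq_iff circle_point_def vec_eq_iff forall_2 axis_def)
  moreover have "continuous_on UNIV (\<lambda>t. cos t *\<^sub>R axis 1 1 + sin t *\<^sub>R axis 2 1 :: plane)"
    by (intro continuous_intros)
  ultimately have "circle_point \<in> borel_measurable borel"
    by (metis borel_measurable_continuous_onI)
  then show "circle_point \<in> borel_measurable (restrict_space lborel {0..<2 * pi})"
    by (intro measurable_restrict_space1) simp
qed

lemma space_arc_length: "space arc_length = sphere 0 1"
  by (simp add: arc_length_def space_restrict_space)

lemma emeasure_arc_length: "emeasure arc_length (sphere 0 1) = ennreal (2 * pi)"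
proof -
  have "emeasure arc_length (space arc_length)
      = emeasure (restrict_space lborel {0..<2 * pi})
          (space (restrict_space lborel {0..<2 * pi}))"
    unfolding arc_length_def
    using measurable_space[OF circle_point_measurable]
    by (subst emeasure_distr[OF circle_point_measurable])
       (auto intro!: arg_cong2[where f = emeasure]
          simp: space_restrict_space sets_restrict_space)
  also have "\<dots> = ennreal (2 * pi)"
    by (simp add: emeasure_restrict_space space_restrict_space)
  finally show ?thesis
    by (simp add: space_arc_length)
qed

lemma ennreal_root_power: "n > 0 \<Longrightarrow> ennreal_root n a ^ n = a"
  by (cases a) (auto simp: ennreal_root_def ennreal_power ennreal_top_eq_mult_iff
      top_power_ennreal)

end

theory Submission
  imports Defs "HOL-Probability.Distributions"
begin

text \<open>
  Averaging \<open>|extension f (r \<omega>)|\<^sup>2\<close> over \<open>\<omega>\<close> turns a pair of exponentials into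
  \<open>J\<^sub>0 (2 r sin (\<alpha> / 2))\<close>, where \<open>\<alpha>\<close> is the angle between the two frequencies. The angular
  \<open>L\<^sup>2\<close> norm is therefore the mean \<open>Q\<^sub>a r\<close> (\<open>angular_mean a r\<close>) of this kernel against the autocorrelation \<open>a \<alpha>\<close> of
  \<open>f\<close>, and \<open>|a \<alpha>|\<close> is at most the energy \<open>a 0\<close>. For constant \<open>f\<close> one gets \<open>a = a 0\<close> and
  \<open>Q\<^sub>1 = J\<^sub>0\<^sup>2\<close>.

  By the product formula for \<open>J\<^sub>0\<close> and the Gaussian transform
  \<open>\<integral> J\<^sub>0 (s r) r exp (- (r / c)\<^sup>2) dr \<ge> 0\<close>, the trilinear form
  \<open>\<integral> Q\<^sub>a Q\<^sub>b Q\<^sub>c r exp (- (r / c)\<^sup>2) dr\<close> is monotone in nonnegative \<open>a\<close>, \<open>b\<close>, \<open>c\<close>. Hence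
  \<open>\<integral> Q\<^sub>a\<^sup>3 r dr\<close> is largest for constant \<open>a\<close>, with a deficit that controls \<open>a\<^sup>2 - (a 0)\<^sup>2\<close>.
  In the case of equality \<open>a = \<plusminus> a 0\<close> almost everywhere, so that almost every rotation maps \<open>f\<close> to
  \<open>\<plusminus> f\<close>; squaring rotations removes the sign, and \<open>f\<close> is constant.
\<close>

section \<open>The uniform measure on the circle\<close>

text \<open>Against the bare weight r dr the product formula cannot be combined with an exchange of
  integrals: \<open>bessel_J 0 (s * r)\<close> times r is not absolutely integrable, and the kernels
  have no sign that would permit Tonelli. The Gaussian factor makes the radial measure finite, so
  boundedness justifies every exchange there. It is removed at the end by Fatou's lemma, which needs
  a nonnegative integrand; this is where it matters that the angular mean of a correlation is an
  integral of a squared modulus. A strict inequality could be lost in that limit, so an explicit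
  nonnegative deficit is carried through it together with the cube.

  Asymptotics of the Bessel function enter only as a bound on r times its square, which makes
  I(0,0,0) finite.

  Angles carry a probability measure: constants are their own means, and the factor 1/(2 pi) of the
  extension operator is absorbed.\<close>

definition circ :: "real measure" where
  "circ = uniform_measure lborel {0..<2 * pi}"

lemma sets_circ [simp, measurable_cong]: "sets circ = sets borel"
  by (simp add: circ_def)

lemma space_circ [simp]: "space circ = UNIV"
  by (simp add: circ_def uniform_measure_def)

lemma circ_eq_density:
  "circ = density lborel (\<lambda>t. ennreal (indicator {0..<2 * pi} t / (2 * pi)))"
  unfolding circ_def uniform_measure_def
  by (intro density_cong) (auto split: split_indicator simp: divide_ennreal[symmetric])

interpretation circ: prob_space circ
  unfolding circ_def by (rule prob_space_uniform_measure) auto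

lemma circ_pair_sigma_finite: "pair_sigma_finite circ circ"
  by (intro pair_sigma_finite.intro circ.sigma_finite_measure_axioms)

lemma nn_integral_circ:
  assumes "f \<in> borel_measurable borel"
  shows "(\<integral>\<^sup>+t. f t \<partial>circ) = (\<integral>\<^sup>+t. f t * indicator {0..<2 * pi} t \<partial>lborel) / ennreal (2 * pi)"
  unfolding circ_def using assms by (subst nn_integral_uniform_measure) auto

lemma integral_circ:
  fixes f :: "real \<Rightarrow> 'a :: {banach, second_countable_topology}"
  assumes "f \<in> borel_measurable borel"
  shows "(\<integral>t. f t \<partial>circ) = (1 / (2 * pi)) *\<^sub>R (\<integral>t. indicator {0..<2 * pi} t *\<^sub>R f t \<partial>lborel)"
proof -
  have "(\<integral>t. f t \<partial>circ) = (\<integral>t. (indicator {0..<2 * pi} t / (2 * pi)) *\<^sub>R f t \<partial>lborel)"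
    unfolding circ_eq_density using assms by (intro integral_density) auto
  also have "\<dots> = (\<integral>t. (1 / (2 * pi)) *\<^sub>R (indicator {0..<2 * pi} t *\<^sub>R f t) \<partial>lborel)"
    by simp
  finally show ?thesis
    by (simp only: integral_scaleR_right)
qed

lemma AE_circ_iff:
  assumes [measurable]: "Measurable.pred borel P"
  shows "(AE t in circ. P t) \<longleftrightarrow> (AE t in lborel. t \<in> {0..<2 * pi} \<longrightarrow> P t)"
  unfolding circ_def by (subst AE_uniform_measure) auto

text \<open>Null sets expressed through integrals, so that every invariance of nonnegative integrals
  yields one of almost-everywhere statements.\<close>

lemma AE_circ_iff_nn_integral:
  assumes [measurable]: "Measurable.pred borel P"
  shows "(AE t in circ. P t) \<longleftrightarrow> (\<integral>\<^sup>+t. indicator {t. \<not> P t} t \<partial>circ) = 0"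
  by (subst nn_integral_0_iff_AE) (auto simp: indicator_def)

section \<open>Translation invariance for periodic functions\<close>

lemma nn_integral_circ_shift_aux:
  fixes f :: "real \<Rightarrow> ennreal"
  assumes [measurable]: "f \<in> borel_measurable borel"
    and periodic: "\<And>t. f (t + 2 * pi) = f t" and b: "0 \<le> b" "b \<le> 2 * pi"
  shows "(\<integral>\<^sup>+t. f (t + b) \<partial>circ) = (\<integral>\<^sup>+t. f t \<partial>circ)"
proof -
  have "(\<integral>\<^sup>+t. f (t + b) * indicator {0..<2 * pi} t \<partial>lborel)
      = (\<integral>\<^sup>+t. f t * indicator {b..<2 * pi + b} t \<partial>lborel)"
    by (subst nn_integral_real_affine[of "\<lambda>t. f t * indicator {b..<2 * pi + b} t" 1 b])
       (auto intro!: nn_integral_cong simp: add.commute split: split_indicator)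
  also have "\<dots> = (\<integral>\<^sup>+t. f t * indicator {b..<2 * pi} t + f t * indicator {2 * pi..<2 * pi + b} t \<partial>lborel)"
    using b by (intro nn_integral_cong) (auto split: split_indicator)
  also have "\<dots> = (\<integral>\<^sup>+t. f t * indicator {b..<2 * pi} t \<partial>lborel)
      + (\<integral>\<^sup>+t. f t * indicator {2 * pi..<2 * pi + b} t \<partial>lborel)"
    by (rule nn_integral_add) auto
  \<comment> \<open>The part of the shifted period that sticks out beyond 2 pi is moved back by one
    period.\<close>
  also have "(\<integral>\<^sup>+t. f t * indicator {2 * pi..<2 * pi + b} t \<partial>lborel)
      = (\<integral>\<^sup>+t. f t * indicator {0..<b} t \<partial>lborel)"
    by (subst nn_integral_real_affine[of "\<lambda>t. f t * indicator {2 * pi..<2 * pi + b} t" 1 "2 * pi"])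
       (auto intro!: nn_integral_cong simp: add.commute[of "2 * pi"] periodic split: split_indicator)
  also have "(\<integral>\<^sup>+t. f t * indicator {b..<2 * pi} t \<partial>lborel) + (\<integral>\<^sup>+t. f t * indicator {0..<b} t \<partial>lborel)
      = (\<integral>\<^sup>+t. f t * indicator {b..<2 * pi} t + f t * indicator {0..<b} t \<partial>lborel)"
    by (rule nn_integral_add[symmetric]) auto
  also have "\<dots> = (\<integral>\<^sup>+t. f t * indicator {0..<2 * pi} t \<partial>lborel)"
    using b by (intro nn_integral_cong) (auto split: split_indicator)
  finally show ?thesis
    by (simp add: nn_integral_circ)
qed

text \<open>Reduction of an angle modulo 2 pi. It brings an arbitrary shift into the range of the
  auxiliary lemma, and every periodic function factors through it, which reduces invariance for
  Bochner integrals to an equality of image measures.\<close>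

definition wrap :: "real \<Rightarrow> real" where
  "wrap t = t - 2 * pi * of_int \<lfloor>t / (2 * pi)\<rfloor>"

lemma wrap_measurable [measurable]: "wrap \<in> borel_measurable borel"
  unfolding wrap_def by measurable

lemma wrap_bounds: "0 \<le> wrap t" "wrap t \<le> 2 * pi"
proof -
  have "wrap t = 2 * pi * frac (t / (2 * pi))"
    by (simp add: wrap_def frac_def algebra_simps)
  moreover have "0 \<le> frac (t / (2 * pi))" "frac (t / (2 * pi)) \<le> 1"
    using frac_lt_1[of "t / (2 * pi)"] by auto
  ultimately show "0 \<le> wrap t" "wrap t \<le> 2 * pi"
    by (auto intro: mult_left_le)
qed

lemma wrap_periodic: "wrap (t + 2 * pi) = wrap t"
proof -
  have "(t + 2 * pi) / (2 * pi) = t / (2 * pi) + 1"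
    by (simp add: field_simps)
  then show ?thesis
    by (simp add: wrap_def algebra_simps)
qed

lemma periodic_int:
  assumes periodic: "\<And>t. f (t + 2 * pi) = f (t::real)"
  shows "f (t + 2 * pi * of_int k) = f t"
proof (induction k rule: int_induct[where k = 0])
  case (step1 i)
  then show ?case using periodic[of "t + 2 * pi * of_int i"] by (simp add: algebra_simps)
next
  case (step2 i)
  then show ?case using periodic[of "t + 2 * pi * of_int (i - 1)"] by (simp add: algebra_simps)
qed simp

lemma periodic_wrap:
  assumes periodic: "\<And>t. f (t + 2 * pi) = f (t::real)"
  shows "f (wrap t) = f t"
  using periodic_int[of f "wrap t" "\<lfloor>t / (2 * pi)\<rfloor>", OF periodic] by (simp add: wrap_def)

lemma nn_integral_circ_shift:
  fixes f :: "real \<Rightarrow> ennreal"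
  assumes f: "f \<in> borel_measurable borel" and periodic: "\<And>t. f (t + 2 * pi) = f t"
  shows "(\<integral>\<^sup>+t. f (t + b) \<partial>circ) = (\<integral>\<^sup>+t. f t \<partial>circ)"
proof -
  have "f (t + b) = f (t + wrap b)" for t
    using periodic_int[of f "t + wrap b" "\<lfloor>b / (2 * pi)\<rfloor>", OF periodic]
    by (simp add: wrap_def algebra_simps)
  then show ?thesis
    using nn_integral_circ_shift_aux[OF f periodic wrap_bounds[of b]] by simp
qed

text \<open>For a Borel set A, the indicator of A composed with \<open>wrap\<close> is a periodic
  nonnegative function, so the nonnegative case applies. Equality of the image measures then covers
  Banach-valued functions with no integrability hypothesis.\<close>

lemma distr_circ_wrap_shift: "distr circ borel (\<lambda>t. wrap (t + b)) = distr circ borel wrap"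
proof (rule measure_eqI)
  fix A assume "A \<in> sets (distr circ borel (\<lambda>t. wrap (t + b)))"
  then have [measurable]: "A \<in> sets borel" by simp
  have "(\<integral>\<^sup>+t. indicator A (wrap (t + b)) \<partial>circ) = (\<integral>\<^sup>+t. indicator A (wrap t) \<partial>circ)"
    by (rule nn_integral_circ_shift) (auto simp: wrap_periodic)
  then show "emeasure (distr circ borel (\<lambda>t. wrap (t + b))) A = emeasure (distr circ borel wrap) A"
    by (simp add: nn_integral_distr flip: nn_integral_indicator)
qed simp

lemma integral_circ_shift:
  fixes f :: "real \<Rightarrow> 'a :: {banach, second_countable_topology}"
  assumes [measurable]: "f \<in> borel_measurable borel" and periodic: "\<And>t. f (t + 2 * pi) = f t"
  shows "(\<integral>t. f (t + b) \<partial>circ) = (\<integral>t. f t \<partial>circ)"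
proof -
  have "(\<integral>t. f (t + b) \<partial>circ) = (\<integral>t. f (wrap (t + b)) \<partial>circ)"
    by (simp add: periodic_wrap[of f, OF periodic])
  also have "\<dots> = (\<integral>t. f t \<partial>distr circ borel (\<lambda>t. wrap (t + b)))"
    by (subst integral_distr) auto
  also have "\<dots> = (\<integral>t. f (wrap t) \<partial>circ)"
    unfolding distr_circ_wrap_shift by (subst integral_distr) auto
  finally show ?thesis
    by (simp add: periodic_wrap[of f, OF periodic])
qed

lemma integrable_circ_shift:
  fixes f :: "real \<Rightarrow> 'a :: {banach, second_countable_topology}"
  assumes [measurable]: "f \<in> borel_measurable borel" and periodic: "\<And>t. f (t + 2 * pi) = f t"
    and int: "integrable circ f"
  shows "integrable circ (\<lambda>t. f (t + b))"
proof -
  have "(\<integral>\<^sup>+t. norm (f (t + b)) \<partial>circ) = (\<integral>\<^sup>+t. norm (f t) \<partial>circ)"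
    by (rule nn_integral_circ_shift) (auto simp: periodic)
  with int show ?thesis
    by (auto simp: integrable_iff_bounded)
qed

lemma AE_circ_shift:
  assumes [measurable]: "Measurable.pred borel P" and periodic: "\<And>t. P (t + 2 * pi) = P t"
  shows "(AE t in circ. P (t + b)) \<longleftrightarrow> (AE t in circ. P t)"
proof -
  have "(\<integral>\<^sup>+t. indicator {t. \<not> P t} (t + b) \<partial>circ) = (\<integral>\<^sup>+t. indicator {t. \<not> P t} t \<partial>circ)"
    by (rule nn_integral_circ_shift) (auto simp: periodic indicator_def)
  moreover have "(\<integral>\<^sup>+t. indicator {t. \<not> P t} (t + b) \<partial>circ) = (\<integral>\<^sup>+t. indicator {t. \<not> P (t + b)} t \<partial>circ)"
    by (auto intro!: nn_integral_cong simp: indicator_def)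
  ultimately show ?thesis
    by (simp add: AE_circ_iff_nn_integral)
qed

text \<open>The halved angle stays in the interval, and scaling preserves null sets. This passes
  from almost every rotation to the square root of almost every rotation.\<close>

lemma AE_circ_halve:
  assumes [measurable]: "Measurable.pred borel P" and "AE t in circ. P t"
  shows "AE t in circ. P (t / 2)"
proof -
  have "AE t in lborel. t \<in> {0..<2 * pi} \<longrightarrow> P t"
    using assms by (simp add: AE_circ_iff)
  then have "AE t in lborel. (0 + (1 / 2) * t) \<in> {0..<2 * pi} \<longrightarrow> P (0 + (1 / 2) * t)"
    by (intro AE_borel_affine[where P = "\<lambda>t. t \<in> {0..<2 * pi} \<longrightarrow> P t"]) auto
  then have "AE t in lborel. t \<in> {0..<2 * pi} \<longrightarrow> P (t / 2)"
    by eventually_elim auto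
  then show ?thesis
    by (subst AE_circ_iff) auto
qed

section \<open>Transfer between arc length and the angle\<close>

lemma circle_point_periodic: "circle_point (t + 2 * pi) = circle_point t"
  by (simp add: circle_point_def)

lemma circle_point_borel_measurable [measurable]: "circle_point \<in> borel_measurable borel"
proof -
  have "circle_point = (\<lambda>t. cos t *\<^sub>R axis 1 1 + sin t *\<^sub>R axis 2 1)"
    by (auto simp: fun_eq_iff circle_point_def vec_eq_iff forall_2 axis_def)
  moreover have "continuous_on UNIV (\<lambda>t. cos t *\<^sub>R axis 1 1 + sin t *\<^sub>R axis 2 1 :: plane)"
    by (intro continuous_intros)
  ultimately show ?thesis
    by (metis borel_measurable_continuous_onI)
qed

lemma circle_point_in_sphere: "circle_point t \<in> sphere 0 1"
  by (auto simp: circle_point_def norm_vec_def L2_set_def sum_2)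

lemma circle_point_measurable_sphere:
  "circle_point \<in> borel \<rightarrow>\<^sub>M restrict_space borel (sphere 0 1)"
  using circle_point_in_sphere by (intro measurable_restrict_space2) auto

lemma sets_arc_length: "sets arc_length = sets (restrict_space borel (sphere 0 1))"
  by (simp add: arc_length_def)

lemma measurable_arc_length_compose:
  assumes "F \<in> measurable arc_length N"
  shows "(\<lambda>t. F (circle_point t)) \<in> measurable borel N"
  using assms circle_point_measurable_sphere
  by (auto intro: measurable_compose simp: arc_length_def)

lemma nn_integral_arc_length:
  assumes F: "F \<in> borel_measurable arc_length"
  shows "(\<integral>\<^sup>+\<omega>. F \<omega> \<partial>arc_length) = ennreal (2 * pi) * (\<integral>\<^sup>+t. F (circle_point t) \<partial>circ)"
proof -
  note [measurable] = measurable_arc_length_compose[OF F]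
  have "(\<integral>\<^sup>+\<omega>. F \<omega> \<partial>arc_length) = (\<integral>\<^sup>+t. F (circle_point t) \<partial>restrict_space lborel {0..<2 * pi})"
    unfolding arc_length_def using F
    by (intro nn_integral_distr circle_point_measurable) (simp add: arc_length_def)
  also have "\<dots> = (\<integral>\<^sup>+t. F (circle_point t) * indicator {0..<2 * pi} t \<partial>lborel)"
    by (rule nn_integral_restrict_space) simp
  also have "\<dots> = ennreal (2 * pi) * (\<integral>\<^sup>+t. F (circle_point t) \<partial>circ)"
    by (simp add: nn_integral_circ ennreal_times_divide mult.commute[of "ennreal _"]
        ennreal_mult_divide_eq)
  finally show ?thesis .
qed

lemma integral_arc_length:
  fixes F :: "plane \<Rightarrow> 'a :: {banach, second_countable_topology}"
  assumes F: "F \<in> borel_measurable arc_length"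
  shows "(\<integral>\<omega>. F \<omega> \<partial>arc_length) = (2 * pi) *\<^sub>R (\<integral>t. F (circle_point t) \<partial>circ)"
proof -
  note [measurable] = measurable_arc_length_compose[OF F]
  have "(\<integral>\<omega>. F \<omega> \<partial>arc_length) = (\<integral>t. F (circle_point t) \<partial>restrict_space lborel {0..<2 * pi})"
    unfolding arc_length_def using F
    by (intro integral_distr circle_point_measurable) (simp add: arc_length_def)
  also have "\<dots> = (\<integral>t. indicator {0..<2 * pi} t *\<^sub>R F (circle_point t) \<partial>lborel)"
    by (rule integral_restrict_space) simp
  finally show ?thesis
    by (simp add: integral_circ)
qed

lemma integrable_arc_length:
  fixes F :: "plane \<Rightarrow> 'a :: {banach, second_countable_topology}"
  assumes F: "F \<in> borel_measurable arc_length"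
  shows "integrable arc_length F \<longleftrightarrow> integrable circ (\<lambda>t. F (circle_point t))"
proof -
  note [measurable] = measurable_arc_length_compose[OF F]
  show ?thesis
    using F by (auto simp: integrable_iff_bounded nn_integral_arc_length ennreal_mult_less_top
        intro: ennreal_zero_less_top)
qed

lemma AE_arc_length_iff:
  assumes P: "Measurable.pred arc_length P"
  shows "(AE \<omega> in arc_length. P \<omega>) \<longleftrightarrow> (AE t in circ. P (circle_point t))"
proof -
  note [measurable] = P measurable_arc_length_compose[OF P]
  have "(AE \<omega> in arc_length. P \<omega>) \<longleftrightarrow> (\<integral>\<^sup>+\<omega>. indicator {\<omega>\<in>space arc_length. \<not> P \<omega>} \<omega> \<partial>arc_length) = 0"
    by (subst nn_integral_0_iff_AE) (auto simp: indicator_def intro!: AE_cong)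
  also have "(\<integral>\<^sup>+\<omega>. indicator {\<omega>\<in>space arc_length. \<not> P \<omega>} \<omega> \<partial>arc_length)
      = ennreal (2 * pi) * (\<integral>\<^sup>+t. indicator {\<omega>\<in>space arc_length. \<not> P \<omega>} (circle_point t) \<partial>circ)"
    by (rule nn_integral_arc_length) measurable
  also have "(\<integral>\<^sup>+t. indicator {\<omega>\<in>space arc_length. \<not> P \<omega>} (circle_point t) \<partial>circ)
      = (\<integral>\<^sup>+t. indicator {t. \<not> P (circle_point t)} t \<partial>circ)"
    using circle_point_in_sphere
    by (intro nn_integral_cong) (auto simp: indicator_def space_arc_length)
  also have "ennreal (2 * pi) * \<dots> = 0 \<longleftrightarrow> \<dots> = 0"
    by simp
  finally show ?thesis
    by (simp add: AE_circ_iff_nn_integral)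
qed

section \<open>The Bessel function of order zero\<close>

lemma integral_circ_deriv_zero:
  fixes F f :: "real \<Rightarrow> real"
  assumes deriv: "\<And>t. (F has_real_derivative f t) (at t)"
    and cont: "continuous_on UNIV f" and F: "F (2 * pi) = F 0"
  shows "(\<integral>t. f t \<partial>circ) = 0"
proof -
  have [measurable]: "f \<in> borel_measurable borel"
    using cont by (rule borel_measurable_continuous_onI)
  have "(\<integral>t. indicator {0..<2 * pi} t *\<^sub>R f t \<partial>lborel) = (\<integral>t. indicator {0..2 * pi} t *\<^sub>R f t \<partial>lborel)"
  proof (rule integral_cong_AE)
    show "AE t in lborel. indicator {0..<2 * pi} t *\<^sub>R f t = indicator {0..2 * pi} t *\<^sub>R f t"
      using AE_lborel_singleton[of "2 * pi"]
      by eventually_elim (auto split: split_indicator)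
  qed measurable
  also have "\<dots> = (\<integral>t. f t * indicator {0..2 * pi} t \<partial>lborel)"
    by (simp add: mult.commute)
  also have "\<dots> = F (2 * pi) - F 0"
    using deriv cont by (intro integral_FTC_Icc_real) (simp_all add: continuous_on_eq_continuous_at)
  finally show ?thesis
    using F by (simp add: integral_circ)
qed

lemma prob_circ_UNIV [simp]: "measure circ UNIV = 1"
  using circ.prob_space by simp

lemma integrable_circ_bounded:
  fixes f :: "real \<Rightarrow> 'a :: {banach, second_countable_topology}"
  assumes "f \<in> borel_measurable borel" and "\<And>t. norm (f t) \<le> B"
  shows "integrable circ f"
  using assms by (intro circ.integrable_const_bound[where B = B]) auto

text \<open>The Wallis recursion. Integration by parts takes the form that the derivative of
  \<open>sin t * cos t ^ Suc (2 * m)\<close> has mean zero over a period.\<close>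

lemma integral_cos_power_Suc:
  "(\<integral>t. cos t ^ (2 * Suc m) \<partial>circ) = (2 * real m + 1) / (2 * real m + 2) * (\<integral>t. cos t ^ (2 * m) \<partial>circ)"
proof -
  have int: "integrable circ (\<lambda>t. cos t ^ k)" for k
    by (rule integrable_circ_bounded[where B = 1]) (auto simp: power_abs intro!: power_le_one)
  have "(\<integral>t. (2 * real m + 2) * cos t ^ (2 * Suc m) - (2 * real m + 1) * cos t ^ (2 * m) \<partial>circ) = 0"
  proof (rule integral_circ_deriv_zero[where F = "\<lambda>t. sin t * cos t ^ Suc (2 * m)"])
    fix t :: real
    have "((\<lambda>t. sin t * cos t ^ Suc (2 * m)) has_real_derivative
        cos t * cos t ^ Suc (2 * m) + (1 + real (2 * m)) * (- sin t * cos t ^ (2 * m)) * sin t) (at t)"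
      by (intro DERIV_mult DERIV_sin DERIV_power_Suc DERIV_cos)
    also have "cos t * cos t ^ Suc (2 * m) + (1 + real (2 * m)) * (- sin t * cos t ^ (2 * m)) * sin t
        = cos t * cos t ^ Suc (2 * m) - (2 * m + 1) * (sin t)\<^sup>2 * cos t ^ (2 * m)"
      by (simp add: power2_eq_square algebra_simps)
    also have "\<dots> = (2 * real m + 2) * cos t ^ (2 * Suc m) - (2 * real m + 1) * cos t ^ (2 * m)"
      unfolding sin_squared_eq by (simp add: power2_eq_square algebra_simps)
    finally show "((\<lambda>t. sin t * cos t ^ Suc (2 * m)) has_real_derivative
        (2 * real m + 2) * cos t ^ (2 * Suc m) - (2 * real m + 1) * cos t ^ (2 * m)) (at t)" .
  qed (auto intro!: continuous_intros)
  moreover have "(\<integral>t. (2 * real m + 2) * cos t ^ (2 * Suc m) - (2 * real m + 1) * cos t ^ (2 * m) \<partial>circ)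
      = (2 * real m + 2) * (\<integral>t. cos t ^ (2 * Suc m) \<partial>circ) - (2 * real m + 1) * (\<integral>t. cos t ^ (2 * m) \<partial>circ)"
    by (subst Bochner_Integration.integral_diff)
       (auto intro!: int integrable_mult_right simp del: mult_Suc_right power_Suc)
  ultimately have eq: "(2 * real m + 2) * (\<integral>t. cos t ^ (2 * Suc m) \<partial>circ)
      = (2 * real m + 1) * (\<integral>t. cos t ^ (2 * m) \<partial>circ)"
    by simp
  have solve: "a \<noteq> 0 \<Longrightarrow> a * x = b * y \<Longrightarrow> x = b / a * y" for a b x y :: real
    by (simp add: eq_divide_eq mult.commute)
  show ?thesis
    by (rule solve[OF _ eq]) simp
qed

text \<open>The central binomial coefficient over 4^m. Its factor (2 m)! cancels the one in the
  cosine series, which is how the squared factorial in the series of \<open>bessel_J 0\<close>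
  arises.\<close>

lemma integral_cos_power:
  "(\<integral>t. cos t ^ (2 * m) \<partial>circ) = fact (2 * m) / (4 ^ m * (fact m)\<^sup>2)"
proof (induction m)
  case 0
  show ?case by simp
next
  case (Suc m)
  have "fact (2 * Suc m) / (4 ^ Suc m * (fact (Suc m))\<^sup>2)
      = ((2 * m + 2) * (2 * m + 1) * fact (2 * m)) / (4 * 4 ^ m * ((m + 1)\<^sup>2 * (fact m)\<^sup>2))"
  proof -
    have "fact (2 * Suc m) = ((2 * m + 2) * (2 * m + 1) * fact (2 * m) :: real)"
      by (simp add: algebra_simps)
    moreover have "(fact (Suc m))\<^sup>2 = ((m + 1)\<^sup>2 * (fact m)\<^sup>2 :: real)"
      by (simp add: power_mult_distrib)
    ultimately show ?thesis
      by simp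
  qed
  also have "\<dots> = (2 * real m + 1) / (2 * real m + 2) * (fact (2 * m) / (4 ^ m * (fact m)\<^sup>2))"
  proof -
    have "2 * b * c * F / (4 * Q * (b\<^sup>2 * G)) = c / (2 * b) * (F / (Q * G))" for b c F Q G :: real
      by (cases "b = 0") (simp_all add: power2_eq_square mult_ac)
    from this[of "real m + 1" "2 * real m + 1" "fact (2 * m)" "4 ^ m" "(fact m)\<^sup>2"] show ?thesis
      by (simp add: algebra_simps)
  qed
  also have "\<dots> = (2 * real m + 1) / (2 * real m + 2) * (\<integral>t. cos t ^ (2 * m) \<partial>circ)"
    by (rule arg_cong[OF Suc.IH[symmetric]])
  also have "\<dots> = (\<integral>t. cos t ^ (2 * Suc m) \<partial>circ)"
    by (rule integral_cos_power_Suc[symmetric])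
  finally show ?case
    by (rule sym)
qed

lemma bessel_J0_series: "bessel_J 0 x = (\<Sum>m. (- 1) ^ m / (fact m)\<^sup>2 * (x\<^sup>2 / 4) ^ m)"
  by (simp add: bessel_J_def power2_eq_square power_mult power_divide)

lemma bessel_J0_abs [simp]: "bessel_J 0 \<bar>x\<bar> = bessel_J 0 x"
  by (simp add: bessel_J0_series)

lemma bessel_J0_minus [simp]: "bessel_J 0 (- x) = bessel_J 0 x"
  by (simp add: bessel_J0_series)

text \<open>The cosine series is integrated term by term; the even terms of the exponential series
  at \<open>\<bar>x\<bar>\<close> majorize it uniformly in t.\<close>

lemma bessel_J0_eq_integral: "bessel_J 0 x = (\<integral>t. cos (x * cos t) \<partial>circ)"
proof -
  define f where "f m t = (- 1) ^ m / fact (2 * m) * (x * cos t) ^ (2 * m)" for m t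
  have bound: "norm (f m t) \<le> \<bar>x\<bar> ^ (2 * m) / fact (2 * m)" for m t
    by (auto simp: f_def abs_mult power_mult_distrib power_abs divide_simps
        intro!: mult_left_le power_le_one)
  have "summable ((\<lambda>n. \<bar>x\<bar> ^ n / fact n) \<circ> (\<lambda>m. 2 * m))"
    using summable_exp[of "\<bar>x\<bar>"]
    by (intro summable_reindex) (auto simp: inj_on_def divide_inverse_commute)
  then have summ: "summable (\<lambda>m. \<bar>x\<bar> ^ (2 * m) / fact (2 * m))"
    by (simp add: o_def)
  have [measurable]: "f m \<in> borel_measurable borel" for m
    unfolding f_def by measurable
  have int: "integrable circ (f m)" for m
    using bound by (rule integrable_circ_bounded[rotated]) measurable
  have "(\<lambda>m. \<integral>t. f m t \<partial>circ) sums (\<integral>t. (\<Sum>m. f m t) \<partial>circ)"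
  proof (rule sums_integral)
    show "AE t in circ. summable (\<lambda>m. norm (f m t))"
      using bound by (intro AE_I2 summable_comparison_test'[OF summ]) auto
    have "(\<integral>t. norm (f m t) \<partial>circ) \<le> (\<integral>t. \<bar>x\<bar> ^ (2 * m) / fact (2 * m) \<partial>circ)" for m
      using bound int[of m] by (intro integral_mono integrable_norm) auto
    then show "summable (\<lambda>m. \<integral>t. norm (f m t) \<partial>circ)"
      by (intro summable_comparison_test'[OF summ]) auto
  qed (rule int)
  moreover have "(\<Sum>m. f m t) = cos (x * cos t)" for t
    unfolding f_def by (rule sums_unique[symmetric, OF cos_paired])
  moreover have "(\<integral>t. f m t \<partial>circ) = (- 1) ^ m / (fact m)\<^sup>2 * (x\<^sup>2 / 4) ^ m" for m
  proof -
    have "f m t = (- 1) ^ m / fact (2 * m) * (x\<^sup>2) ^ m * cos t ^ (2 * m)" for t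
      by (simp add: f_def power_mult_distrib power_mult)
    then have "(\<integral>t. f m t \<partial>circ) = (- 1) ^ m / fact (2 * m) * (x\<^sup>2) ^ m * (\<integral>t. cos t ^ (2 * m) \<partial>circ)"
      by simp
    then show ?thesis
      by (simp add: integral_cos_power power_divide)
  qed
  ultimately have "(\<lambda>m. (- 1) ^ m / (fact m)\<^sup>2 * (x\<^sup>2 / 4) ^ m) sums (\<integral>t. cos (x * cos t) \<partial>circ)"
    by simp
  then show ?thesis
    unfolding bessel_J0_series by (rule sums_unique[symmetric])
qed

lemma polar_coordinates:
  fixes x y R :: real
  assumes "x\<^sup>2 + y\<^sup>2 = R\<^sup>2"
  obtains a where "x = R * cos a" "y = R * sin a"
proof (cases "R = 0")
  case True
  then show ?thesis using assms that[of 0] by (simp add: sum_power2_eq_zero_iff)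
next
  case False
  then have "(x / R)\<^sup>2 + (y / R)\<^sup>2 = 1"
    using assms by (simp add: power_divide flip: add_divide_distrib)
  then obtain a where "x / R = cos a" "y / R = sin a"
    using sincos_total_2pi by metis
  then show ?thesis using False that[of a] by (simp add: field_simps)
qed

text \<open>In polar coordinates the phase is R times the cosine of a shifted angle, and the shift
  does not affect the mean. The sine integral vanishes because a half turn changes the sign of the
  phase.\<close>

lemma
  assumes "x\<^sup>2 + y\<^sup>2 = R\<^sup>2"
  shows integral_cos_circ: "(\<integral>t. cos (x * cos t + y * sin t) \<partial>circ) = bessel_J 0 R"
    and integral_sin_circ: "(\<integral>t. sin (x * cos t + y * sin t) \<partial>circ) = 0"
proof -
  obtain a where a: "x = R * cos a" "y = R * sin a"
    using assms by (rule polar_coordinates)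
  have *: "x * cos t + y * sin t = R * cos (t + - a)" for t
    by (simp add: a cos_diff algebra_simps)
  show "(\<integral>t. cos (x * cos t + y * sin t) \<partial>circ) = bessel_J 0 R"
    unfolding * bessel_J0_eq_integral
    by (rule integral_circ_shift) auto
  have "(\<integral>t. sin (x * cos t + y * sin t) \<partial>circ) = (\<integral>t. sin (x * cos (t + pi) + y * sin (t + pi)) \<partial>circ)"
    by (rule integral_circ_shift[symmetric]) auto
  also have "\<dots> = (\<integral>t. - sin (x * cos t + y * sin t) \<partial>circ)"
  proof (intro Bochner_Integration.integral_cong refl)
    fix t :: real
    have "x * cos (t + pi) + y * sin (t + pi) = - (x * cos t + y * sin t)"
      by simp
    then show "sin (x * cos (t + pi) + y * sin (t + pi)) = - sin (x * cos t + y * sin t)"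
      by (simp only: sin_minus)
  qed
  also have "\<dots> = - (\<integral>t. sin (x * cos t + y * sin t) \<partial>circ)"
    by simp
  finally show "(\<integral>t. sin (x * cos t + y * sin t) \<partial>circ) = 0"
    by simp
qed

lemma integral_cis_circ:
  assumes "x\<^sup>2 + y\<^sup>2 = R\<^sup>2"
  shows "(\<integral>t. cis (x * cos t + y * sin t) \<partial>circ) = of_real (bessel_J 0 R)"
proof -
  have int: "integrable circ (\<lambda>t. cos (x * cos t + y * sin t))"
    "integrable circ (\<lambda>t. sin (x * cos t + y * sin t))"
    by (rule integrable_circ_bounded[where B = 1]; simp)+
  have "cis (x * cos t + y * sin t)
      = of_real (cos (x * cos t + y * sin t)) + \<i> * of_real (sin (x * cos t + y * sin t))" for t
    by (simp add: complex_eq_iff)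
  then show ?thesis
    using int integral_cos_circ[OF assms] integral_sin_circ[OF assms]
    by (simp add: integral_complex_of_real)
qed

section \<open>Size, differential equation and decay\<close>

lemma abs_bessel_J0_le: "\<bar>bessel_J 0 x\<bar> \<le> 1"
proof -
  have "\<bar>bessel_J 0 x\<bar> \<le> (\<integral>t. norm (cos (x * cos t)) \<partial>circ)"
    unfolding bessel_J0_eq_integral real_norm_def[symmetric] by (rule integral_norm_bound)
  also have "\<dots> \<le> (\<integral>t. 1 \<partial>circ)"
    by (intro integral_mono integrable_circ_bounded[where B = 1]) auto
  finally show ?thesis
    by simp
qed

lemma bessel_J0_0 [simp]: "bessel_J 0 0 = 1"
  by (simp add: bessel_J0_eq_integral)

text \<open>In the variable z = r^2 / 4 the function is an entire series F with z F'' + F' + F = 0,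
  an identity between coefficients. The chain rule turns it into Bessel's equation, written for the
  derivative D.\<close>

lemma bessel_J0_ode:
  obtains D where "\<And>r. (bessel_J 0 has_real_derivative D r) (at r)"
    and "\<And>r. r \<noteq> 0 \<Longrightarrow> (D has_real_derivative - D r / r - bessel_J 0 r) (at r)"
proof -
  define c :: "nat \<Rightarrow> real" where "c m = (- 1) ^ m / (fact m)\<^sup>2" for m :: nat
  have summ: "summable (\<lambda>m. c m * z ^ m)" for z :: real
  proof (rule summable_comparison_test')
    show "summable (\<lambda>m. \<bar>z\<bar> ^ m / fact m)"
      using summable_exp[of "\<bar>z\<bar>"] by (simp add: divide_inverse_commute)
    have "(1::real) \<le> fact m" for m
      by (rule fact_ge_1)
    then show "norm (c m * z ^ m) \<le> \<bar>z\<bar> ^ m / fact m" for m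
      by (auto simp: c_def abs_mult power_abs power2_eq_square divide_simps
          intro!: mult_left_le_one_le mult_le_cancel_left1[THEN iffD2])
  qed
  define F F1 F2 where "F z = (\<Sum>m. c m * z ^ m)" and "F1 z = (\<Sum>m. diffs c m * z ^ m)"
    and "F2 z = (\<Sum>m. diffs (diffs c) m * z ^ m)" for z
  have summ1: "summable (\<lambda>m. diffs c m * z ^ m)" for z
    using summ by (rule termdiff_converges_all)
  have summ2: "summable (\<lambda>m. diffs (diffs c) m * z ^ m)" for z
    using summ1 by (rule termdiff_converges_all)
  have F: "(F has_real_derivative F1 z) (at z)" for z
    unfolding F_def F1_def using summ by (rule termdiffs_strong_converges_everywhere)
  have F1: "(F1 has_real_derivative F2 z) (at z)" for z
    unfolding F1_def F2_def using summ1 by (rule termdiffs_strong_converges_everywhere)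
  have ode: "z * F2 z + F1 z + F z = 0" for z
  proof -
    have "(\<lambda>m. diffs (diffs c) m * z ^ Suc m) sums (z * F2 z)"
      using sums_mult[OF summable_sums[OF summ2[of z]], of z] by (simp add: F2_def mult_ac)
    then have "(\<lambda>m. real (Suc m) * diffs c (Suc m) * z ^ Suc m) sums (z * F2 z)"
      by (simp add: diffs_def)
    then have "(\<lambda>m. real m * diffs c m * z ^ m) sums (z * F2 z)"
      \<comment> \<open>The index is shifted down by one; the new term at m = 0 vanishes because of
        the factor m.\<close>
      by (subst (asm) sums_Suc_iff) simp
    then have "(\<lambda>m. real m * diffs c m * z ^ m + diffs c m * z ^ m + c m * z ^ m) sums
        (z * F2 z + F1 z + F z)"
      unfolding F_def F1_def by (intro sums_add summable_sums summ summ1)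
    moreover have "real m * diffs c m * z ^ m + diffs c m * z ^ m + c m * z ^ m = 0" for m
    proof -
      have "(real m + 1) * diffs c m + c m = 0"
        by (simp add: diffs_def c_def power2_eq_square divide_simps)
      then have "((real m + 1) * diffs c m + c m) * z ^ m = 0"
        by simp
      then show ?thesis
        by (simp add: algebra_simps)
    qed
    ultimately show ?thesis
      using sums_unique2[OF _ sums_zero] by simp
  qed
  have J: "bessel_J 0 = (\<lambda>r. F (r\<^sup>2 / 4))"
    by (auto simp: fun_eq_iff bessel_J0_series F_def c_def)
  define D where "D r = F1 (r\<^sup>2 / 4) * (r / 2)" for r
  have sq: "((\<lambda>r. r\<^sup>2 / 4) has_real_derivative r / 2) (at r)" for r :: real
    by (auto intro!: derivative_eq_intros)
  have D: "(bessel_J 0 has_real_derivative D r) (at r)" for r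
    unfolding J D_def by (rule DERIV_chain2[OF F sq])
  have D': "(D has_real_derivative - D r / r - bessel_J 0 r) (at r)" if "r \<noteq> 0" for r
  proof -
    have "((\<lambda>r. r / 2) has_real_derivative 1 / 2) (at r)"
      by (auto intro!: derivative_eq_intros)
    then have "(D has_real_derivative F2 (r\<^sup>2 / 4) * (r / 2) * (r / 2) + 1 / 2 * F1 (r\<^sup>2 / 4)) (at r)"
      unfolding D_def by (intro DERIV_mult DERIV_chain2[OF F1 sq])
    also have "F2 (r\<^sup>2 / 4) * (r / 2) * (r / 2) + 1 / 2 * F1 (r\<^sup>2 / 4) = - D r / r - bessel_J 0 r"
      using ode[of "r\<^sup>2 / 4"] that by (simp add: J D_def power2_eq_square field_simps)
    finally show ?thesis .
  qed
  show ?thesis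
    using that D D' by blast
qed

lemma bessel_J0_continuous: "continuous_on A (bessel_J 0)"
proof -
  obtain D where "\<And>r. (bessel_J 0 has_real_derivative D r) (at r)"
    by (rule bessel_J0_ode) (rule that)
  then show ?thesis
    using DERIV_continuous continuous_at_imp_continuous_on by blast
qed

lemma bessel_J0_measurable [measurable]: "bessel_J 0 \<in> borel_measurable borel"
  by (intro borel_measurable_continuous_onI bessel_J0_continuous)

text \<open>The function w = sqrt r * J0 satisfies w'' + (1 + 1 / (4 r^2)) w = 0. Its energy w'^2 +
  (1 + 1 / (4 r^2)) w^2 can only decrease, since the coefficient of w^2 decreases, and it dominates
  w^2 = r J0^2.\<close>

lemma bessel_J0_decay: obtains C where "\<And>r. r \<ge> 1 \<Longrightarrow> r * (bessel_J 0 r)\<^sup>2 \<le> C"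
proof -
  obtain D where J: "\<And>r. (bessel_J 0 has_real_derivative D r) (at r)"
    and D: "\<And>r. r \<noteq> 0 \<Longrightarrow> (D has_real_derivative - D r / r - bessel_J 0 r) (at r)"
    by (rule bessel_J0_ode) (rule that)
  define J where "J = bessel_J 0"
  note J = J[folded J_def] and D = D[folded J_def]
  \<comment> \<open>This is the energy of w = sqrt r * J0 expanded in J and D; the completed square
    further down is w'^2.\<close>
  define V where "V r = r * ((D r)\<^sup>2 + (J r)\<^sup>2) + J r * D r + (J r)\<^sup>2 / (2 * r)" for r
  have V': "(V has_real_derivative - (J r)\<^sup>2 / (2 * r\<^sup>2)) (at r)" if "r \<ge> 1" for r
  proof -
    have r: "r \<noteq> 0" using that by simp
    have "(V has_real_derivative (D r)\<^sup>2 + (J r)\<^sup>2 + r * (2 * D r * (- D r / r - J r) + 2 * J r * D r)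
        + (D r * D r + J r * (- D r / r - J r)) + (2 * J r * D r * (2 * r) - (J r)\<^sup>2 * 2) / (2 * r)\<^sup>2) (at r)"
      unfolding V_def using r
      by (auto intro!: derivative_eq_intros J D simp: power2_eq_square algebra_simps)
    also have "(D r)\<^sup>2 + (J r)\<^sup>2 + r * (2 * D r * (- D r / r - J r) + 2 * J r * D r)
        + (D r * D r + J r * (- D r / r - J r)) + (2 * J r * D r * (2 * r) - (J r)\<^sup>2 * 2) / (2 * r)\<^sup>2
        = - (J r)\<^sup>2 / (2 * r\<^sup>2)"
      using r by (simp add: power2_eq_square field_simps)
    finally show ?thesis .
  qed
  have "r * (J r)\<^sup>2 \<le> V 1" if r: "r \<ge> 1" for r
  proof -
    have "V r = r * (D r + J r / (2 * r))\<^sup>2 + r * (J r)\<^sup>2 + (J r)\<^sup>2 / (4 * r)"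
      using r by (simp add: V_def power2_eq_square field_simps)
    moreover have "0 \<le> r * (D r + J r / (2 * r))\<^sup>2" "0 \<le> (J r)\<^sup>2 / (4 * r)"
      using r by auto
    moreover have "V r \<le> V 1"
      using r by (rule DERIV_nonpos_imp_nonincreasing) (use V' in \<open>fastforce\<close>)
    ultimately show ?thesis by linarith
  qed
  then show ?thesis
    using that unfolding J_def by blast
qed

text \<open>The content is finiteness: a divergent Bochner integral would give \<open>I000\<close>
  the default value 0. For r at least 1 the integrand is (r J0^2)^3 / r^2, hence at most a constant
  over r^2; on [0,1] it is at most 1.\<close>

lemma nn_integral_J0_power6:
  "(\<integral>\<^sup>+r. ennreal (indicator {0..} r * (r * bessel_J 0 r ^ 6)) \<partial>lborel) = ennreal I000"
proof -
  obtain C where C: "\<And>r. r \<ge> 1 \<Longrightarrow> r * (bessel_J 0 r)\<^sup>2 \<le> C"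
    by (rule bessel_J0_decay) (rule that)
  have C0: "0 \<le> C"
    using C[of 1] by (smt (verit) zero_le_power2)
  have large: "r * bessel_J 0 r ^ 6 \<le> C ^ 3 / r\<^sup>2" if "r \<ge> 1" for r
  proof -
    have "(r * (bessel_J 0 r)\<^sup>2) ^ 3 \<le> C ^ 3"
      using C[OF that] that by (intro power_mono) auto
    moreover have "(r * (bessel_J 0 r)\<^sup>2) ^ 3 = r\<^sup>2 * (r * bessel_J 0 r ^ 6)"
    proof -
      have "r\<^sup>2 * (r * x ^ 6) = (r * x\<^sup>2) ^ 3" for x :: real
        by (simp add: power_mult_distrib power3_eq_cube power2_eq_square flip: power_add power_mult)
           (simp add: eval_nat_numeral)
      then show ?thesis
        by simp
    qed
    ultimately show ?thesis
      using that by (simp add: pos_le_divide_eq mult.commute)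
  qed
  have small: "r * bessel_J 0 r ^ 6 \<le> 1" if "0 \<le> r" "r \<le> 1" for r
  proof -
    have "bessel_J 0 r ^ 6 = \<bar>bessel_J 0 r\<bar> ^ 6"
      by (simp add: power_even_abs)
    also have "\<dots> \<le> 1"
      by (intro power_le_one abs_bessel_J0_le) auto
    finally show ?thesis
      using that by (intro mult_le_one) (auto simp: zero_le_even_power)
  qed
  have "(\<integral>\<^sup>+r. ennreal (indicator {0..} r * (r * bessel_J 0 r ^ 6)) \<partial>lborel)
     \<le> (\<integral>\<^sup>+r. indicator {0..1} r + ennreal (C ^ 3 / r\<^sup>2) * indicator {1..} r \<partial>lborel)"
  proof (rule nn_integral_mono)
    fix r :: real
    consider "r < 0" | "0 \<le> r" "r < 1" | "r \<ge> 1" by linarith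
    then show "ennreal (indicator {0..} r * (r * bessel_J 0 r ^ 6))
        \<le> indicator {0..1} r + ennreal (C ^ 3 / r\<^sup>2) * indicator {1..} r"
    proof cases
      case 2
      then show ?thesis using small[of r] by (simp flip: ennreal_1)
    next
      case 3
      then have "ennreal (r * bessel_J 0 r ^ 6) \<le> ennreal (C ^ 3 / r\<^sup>2)"
        using large[of r] by (intro ennreal_leI)
      then show ?thesis using 3 by (auto intro: order_trans)
    qed simp
  qed
  also have "\<dots> = 1 + (\<integral>\<^sup>+r. ennreal (C ^ 3 / r\<^sup>2) * indicator {1..} r \<partial>lborel)"
    by (subst nn_integral_add) auto
  also have "(\<integral>\<^sup>+r. ennreal (C ^ 3 / r\<^sup>2) * indicator {1..} r \<partial>lborel) = ennreal (0 - (- (C ^ 3 / 1)))"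
  proof (rule nn_integral_FTC_atLeast[where F = "\<lambda>r. - (C ^ 3 / r)"])
    show "((\<lambda>r. - (C ^ 3 / r)) has_real_derivative C ^ 3 / r\<^sup>2) (at r)" if "1 \<le> r" for r
      using that by (auto intro!: derivative_eq_intros simp: power2_eq_square)
    show "((\<lambda>r. - (C ^ 3 / r)) \<longlongrightarrow> 0) at_top"
      using tendsto_minus[OF tendsto_divide_0[OF tendsto_const
          filterlim_at_top_imp_at_infinity[OF filterlim_ident]], of "C ^ 3"] by simp
  qed (use C0 in auto)
  also have "1 + ennreal (0 - (- (C ^ 3 / 1))) < \<infinity>"
    by simp
  finally have fin: "(\<integral>\<^sup>+r. ennreal (indicator {0..} r * (r * bessel_J 0 r ^ 6)) \<partial>lborel) < \<infinity>" .
  have nonneg: "0 \<le> indicator {0..} r * (r * bessel_J 0 r ^ 6)" for r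
    by (auto split: split_indicator simp: zero_le_even_power)
  have "integrable lborel (\<lambda>r. indicator {0..} r * (r * bessel_J 0 r ^ 6))"
    using fin nonneg by (intro integrableI_nonneg) auto
  then show ?thesis
    using nonneg
    by (subst nn_integral_eq_integral) (auto simp: I000_def set_lebesgue_integral_def mult.commute)
qed

text \<open>The double mean of \<open>k\<close> is computed in both orders. For fixed \<psi> its
  phase is that of a single vector, the difference of vectors of lengths x and y at angle \<psi>,
  which gives the third side of the triangle. For fixed \<phi> the cosine addition formula separates
  x from y, and the sine part has mean zero.\<close>

lemma bessel_J0_product:
  "bessel_J 0 x * bessel_J 0 y = (\<integral>\<psi>. bessel_J 0 (sqrt (x\<^sup>2 + y\<^sup>2 - 2 * x * y * cos \<psi>)) \<partial>circ)"
proof -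
  interpret P: pair_sigma_finite circ circ by (rule circ_pair_sigma_finite)
  define k where "k \<psi> \<phi> = cos (x * cos \<phi> - y * cos (\<phi> - \<psi>))" for \<psi> \<phi>
  have inner: "(\<integral>\<phi>. k \<psi> \<phi> \<partial>circ) = bessel_J 0 (sqrt (x\<^sup>2 + y\<^sup>2 - 2 * x * y * cos \<psi>))" for \<psi>
  proof -
    have "(x - y * cos \<psi>)\<^sup>2 + (- y * sin \<psi>)\<^sup>2
        = x\<^sup>2 + y\<^sup>2 * ((sin \<psi>)\<^sup>2 + (cos \<psi>)\<^sup>2) - 2 * x * y * cos \<psi>"
      by (simp only: power_mult_distrib power2_eq_square algebra_simps)
    then have *: "(x - y * cos \<psi>)\<^sup>2 + (- y * sin \<psi>)\<^sup>2 = x\<^sup>2 + y\<^sup>2 - 2 * x * y * cos \<psi>"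
      by simp
    then have "0 \<le> x\<^sup>2 + y\<^sup>2 - 2 * x * y * cos \<psi>"
      by (metis add_nonneg_nonneg zero_le_power2)
    with * have "(x - y * cos \<psi>)\<^sup>2 + (- y * sin \<psi>)\<^sup>2 = (sqrt (x\<^sup>2 + y\<^sup>2 - 2 * x * y * cos \<psi>))\<^sup>2"
      by simp
    from integral_cos_circ[OF this] show ?thesis
      by (simp add: k_def cos_diff algebra_simps)
  qed
  have outer: "(\<integral>\<psi>. k \<psi> \<phi> \<partial>circ) = cos (x * cos \<phi>) * bessel_J 0 y" for \<phi>
  proof -
    have "(y * cos \<phi>)\<^sup>2 + (y * sin \<phi>)\<^sup>2 = y\<^sup>2 * ((sin \<phi>)\<^sup>2 + (cos \<phi>)\<^sup>2)"
      by (simp only: power_mult_distrib algebra_simps)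
    then have R: "(y * cos \<phi>)\<^sup>2 + (y * sin \<phi>)\<^sup>2 = y\<^sup>2"
      by simp
    have eq: "k \<psi> \<phi> = cos (x * cos \<phi>) * cos (y * cos \<phi> * cos \<psi> + y * sin \<phi> * sin \<psi>)
        + sin (x * cos \<phi>) * sin (y * cos \<phi> * cos \<psi> + y * sin \<phi> * sin \<psi>)" for \<psi>
      unfolding k_def cos_diff by (simp add: algebra_simps)
    have "integrable circ (\<lambda>\<psi>. cos (y * cos \<phi> * cos \<psi> + y * sin \<phi> * sin \<psi>))"
      "integrable circ (\<lambda>\<psi>. sin (y * cos \<phi> * cos \<psi> + y * sin \<phi> * sin \<psi>))"
      by (rule integrable_circ_bounded[where B = 1]; simp)+
    then show ?thesis
      unfolding eq using integral_cos_circ[OF R] integral_sin_circ[OF R] by simp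
  qed
  have "integrable (circ \<Otimes>\<^sub>M circ) (case_prod k)"
  proof -
    interpret PP: prob_space "circ \<Otimes>\<^sub>M circ"
      by (rule prob_space_pair) unfold_locales
    show ?thesis
      unfolding k_def[abs_def]
      by (rule PP.integrable_const_bound[where B = 1])
         (auto simp: k_def split_beta intro!: AE_I2)
  qed
  then have "(\<integral>\<phi>. (\<integral>\<psi>. k \<psi> \<phi> \<partial>circ) \<partial>circ) = (\<integral>\<psi>. (\<integral>\<phi>. k \<psi> \<phi> \<partial>circ) \<partial>circ)"
    by (rule P.Fubini_integral)
  then show ?thesis
    by (simp add: inner outer flip: bessel_J0_eq_integral)
qed

text \<open>For two equal sides r the third side is the chord 2 r sin (\<alpha> / 2) up to sign, and
  \<open>bessel_J 0\<close> is even.\<close>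

lemma bessel_J0_square: "(bessel_J 0 r)\<^sup>2 = (\<integral>\<alpha>. bessel_J 0 (2 * r * sin (\<alpha> / 2)) \<partial>circ)"
proof -
  have "bessel_J 0 (sqrt (r\<^sup>2 + r\<^sup>2 - 2 * r * r * cos \<alpha>)) = bessel_J 0 (2 * r * sin (\<alpha> / 2))" for \<alpha>
  proof -
    have "cos \<alpha> = 1 - 2 * (sin (\<alpha> / 2))\<^sup>2"
      using cos_double_sin[of "\<alpha> / 2"] by simp
    then have "r\<^sup>2 + r\<^sup>2 - 2 * r * r * cos \<alpha> = (2 * r * sin (\<alpha> / 2))\<^sup>2"
      by (simp only: power2_eq_square) (simp add: algebra_simps)
    then show ?thesis
      by (simp only: real_sqrt_abs bessel_J0_abs)
  qed
  then show ?thesis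
    using bessel_J0_product[of r r] by (simp add: power2_eq_square)
qed

section \<open>Positivity of the trilinear form\<close>

lemma summable_power_div_fact: "summable (\<lambda>m. x ^ m / fact m)" for x :: real
  using summable_exp[of x] by (simp add: divide_inverse_commute)

text \<open>Termwise integration: the odd Gaussian moment m! / 2 cancels one of the two factorials
  in the Bessel coefficient and leaves the exponential series at - s^2 / 4. The same cancellation
  with absolute values, the series at s^2 / 4, justifies the exchange of sum and integral.\<close>

lemma gaussian_moment_bessel_J0:
  "(\<integral>u. indicator {0..} u *\<^sub>R (exp (- u\<^sup>2) * u * bessel_J 0 (s * u)) \<partial>lborel) = exp (- s\<^sup>2 / 4) / 2"
proof -
  define c where "c m = (- 1) ^ m / (fact m)\<^sup>2 * (s\<^sup>2 / 4) ^ m" for m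
  define g where "g m u = indicator {0..} u *\<^sub>R (exp (- u\<^sup>2) * u ^ (2 * m + 1))" for m and u :: real
  have g: "has_bochner_integral lborel (g m) (fact m / 2)" for m
    unfolding g_def[abs_def] by (rule gaussian_moment_odd_pos)
  have g_nonneg: "0 \<le> g m u" for m u
    by (simp add: g_def split: split_indicator)
  have "(\<lambda>m. \<integral>u. c m * g m u \<partial>lborel) sums (\<integral>u. (\<Sum>m. c m * g m u) \<partial>lborel)"
  proof (rule sums_integral)
    show "integrable lborel (\<lambda>u. c m * g m u)" for m
      using g[of m] by (simp add: has_bochner_integral_iff)
    have "summable (\<lambda>m. norm (c m) * y ^ m)" if "0 \<le> y" for y
    proof (rule summable_comparison_test')
      show "summable (\<lambda>m. (s\<^sup>2 / 4 * y) ^ m / fact m)"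
        by (rule summable_power_div_fact)
      show "norm (norm (c m) * y ^ m) \<le> (s\<^sup>2 / 4 * y) ^ m / fact m" for m
      proof -
        have "(s\<^sup>2 / 4 * y) ^ m / (fact m * fact m) \<le> (s\<^sup>2 / 4 * y) ^ m / (1 * fact m)"
          using that by (intro divide_left_mono mult_right_mono fact_ge_1) auto
        moreover have "norm (norm (c m) * y ^ m) = (s\<^sup>2 / 4 * y) ^ m / (fact m * fact m)"
          using that unfolding power_mult_distrib
          by (simp add: c_def abs_mult power2_eq_square[of "fact m"])
        ultimately show ?thesis
          by simp
      qed
    qed
    note summ = this
    have "summable (\<lambda>m. indicator {0..} u * exp (- u\<^sup>2) * u * (norm (c m) * (u\<^sup>2) ^ m))" for u :: real
      by (intro summable_mult summ) simp
    then have "summable (\<lambda>m. norm (c m * g m u))" for u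
      by (rule summable_cong[THEN iffD1, rotated])
         (auto simp: g_def abs_mult power_mult split: split_indicator)
    then show "AE u in lborel. summable (\<lambda>m. norm (c m * g m u))"
      by simp
    have "(\<integral>u. norm (c m * g m u) \<partial>lborel) = norm (c m) * (fact m / 2)" for m
    proof -
      have "(\<integral>u. norm (c m * g m u) \<partial>lborel) = (\<integral>u. norm (c m) * g m u \<partial>lborel)"
        using g_nonneg by (simp add: abs_mult)
      then show ?thesis
        using g[of m] by (simp add: has_bochner_integral_integral_eq)
    qed
    moreover have "norm (c m) * (fact m / 2) = (s\<^sup>2 / 4) ^ m / fact m * (1 / 2)" for m
      by (simp add: c_def abs_mult power2_eq_square)
    moreover have "summable (\<lambda>m. (s\<^sup>2 / 4) ^ m / fact m * (1 / 2))"
      by (intro summable_mult2 summable_power_div_fact)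
    ultimately show "summable (\<lambda>m. \<integral>u. norm (c m * g m u) \<partial>lborel)"
      by (simp only:)
  qed
  moreover have "(\<Sum>m. c m * g m u) = indicator {0..} u *\<^sub>R (exp (- u\<^sup>2) * u * bessel_J 0 (s * u))" for u
  proof -
    have eq: "c m * g m u = (indicator {0..} u * exp (- u\<^sup>2) * u) *
        ((- 1) ^ m / (fact m)\<^sup>2 * ((s * u)\<^sup>2 / 4) ^ m)" for m
      by (simp add: c_def g_def power_mult power_mult_distrib power_divide)
    have summ: "summable (\<lambda>m. (- 1) ^ m / (fact m)\<^sup>2 * ((s * u)\<^sup>2 / 4) ^ m)"
    proof (rule summable_comparison_test')
      show "summable (\<lambda>m. ((s * u)\<^sup>2 / 4) ^ m / fact m)"
        by (rule summable_power_div_fact)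
      show "norm ((- 1) ^ m / (fact m)\<^sup>2 * ((s * u)\<^sup>2 / 4) ^ m) \<le> ((s * u)\<^sup>2 / 4) ^ m / fact m" for m
      proof -
        have "((s * u)\<^sup>2 / 4) ^ m / (fact m * fact m) \<le> ((s * u)\<^sup>2 / 4) ^ m / (1 * fact m)"
          by (intro divide_left_mono mult_right_mono fact_ge_1) auto
        then show ?thesis
          by (simp add: abs_mult power2_eq_square)
      qed
    qed
    have "(\<Sum>m. c m * g m u) = (indicator {0..} u * exp (- u\<^sup>2) * u) * bessel_J 0 (s * u)"
      unfolding eq bessel_J0_series by (rule suminf_mult[OF summ])
    then show ?thesis
      by simp
  qed
  moreover have "(\<integral>u. c m * g m u \<partial>lborel) = inverse (fact m) * (- s\<^sup>2 / 4) ^ m * (1 / 2)" for m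
    using g[of m]
    by (simp add: c_def has_bochner_integral_integral_eq power2_eq_square divide_simps
        flip: power_mult_distrib)
  moreover have exp: "(\<lambda>m. inverse (fact m) * (- s\<^sup>2 / 4) ^ m * (1 / 2)) sums (exp (- s\<^sup>2 / 4) * (1 / 2))"
    using exp_converges[of "- s\<^sup>2 / 4"] by (intro sums_mult2) (simp only: real_scaleR_def)
  ultimately have "(\<lambda>m. inverse (fact m) * (- s\<^sup>2 / 4) ^ m * (1 / 2)) sums
      (\<integral>u. indicator {0..} u *\<^sub>R (exp (- u\<^sup>2) * u * bessel_J 0 (s * u)) \<partial>lborel)"
    by (simp only:)
  from sums_unique2[OF this exp] show ?thesis
    by simp
qed

text \<open>The radial part r dr of planar Lebesgue measure with a Gaussian cutoff at scale c; the
  cutoff disappears as c tends to infinity.\<close>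

definition gauss :: "real \<Rightarrow> real measure" where
  "gauss c = density lborel (\<lambda>r. ennreal (indicator {0..} r * (r * exp (- (r / c)\<^sup>2))))"

lemma sets_gauss [simp, measurable_cong]: "sets (gauss c) = sets borel"
  by (simp add: gauss_def)

lemma space_gauss [simp]: "space (gauss c) = UNIV"
  by (simp add: gauss_def)

lemma gauss_density_nonneg: "0 \<le> indicator {0..} r * (r * exp (- (r / c)\<^sup>2))" for r :: real
  by (simp split: split_indicator)

lemma finite_measure_gauss:
  assumes "c > 0"
  shows "finite_measure (gauss c)"
proof
  have "emeasure (gauss c) (space (gauss c))
      = (\<integral>\<^sup>+r. ennreal (indicator {0..} r * (r * exp (- (r / c)\<^sup>2))) \<partial>lborel)"
    unfolding gauss_def by (subst emeasure_density) auto
  also have "\<dots> = ennreal \<bar>c\<bar> * (\<integral>\<^sup>+u. ennreal (indicator {0..} (0 + c * u) * ((0 + c * u) * exp (- ((0 + c * u) / c)\<^sup>2))) \<partial>lborel)"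
    using assms by (intro nn_integral_real_affine) auto
  also have "(\<lambda>u. indicator {0..} (0 + c * u) * ((0 + c * u) * exp (- ((0 + c * u) / c)\<^sup>2)))
      = (\<lambda>u. c * (indicator {0..} u *\<^sub>R (exp (- u\<^sup>2) * u ^ (2 * 0 + 1))))"
    using assms by (auto simp: fun_eq_iff zero_le_mult_iff split: split_indicator)
  also have "(\<integral>\<^sup>+u. ennreal (c * (indicator {0..} u *\<^sub>R (exp (- u\<^sup>2) * u ^ (2 * 0 + 1)))) \<partial>lborel)
      = ennreal (c * (fact 0 / 2))"
  proof (rule nn_integral_eq_integral[THEN trans])
    have int: "has_bochner_integral lborel (\<lambda>u. c * (indicator {0..} u *\<^sub>R (exp (- u\<^sup>2) * u ^ (2 * 0 + 1)))) (c * (fact 0 / 2))"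
      by (intro has_bochner_integral_mult_right gaussian_moment_odd_pos)
    then show "integrable lborel (\<lambda>u. c * (indicator {0..} u *\<^sub>R (exp (- u\<^sup>2) * u ^ (2 * 0 + 1))))"
      "ennreal (\<integral>u. c * (indicator {0..} u *\<^sub>R (exp (- u\<^sup>2) * u ^ (2 * 0 + 1))) \<partial>lborel) = ennreal (c * (fact 0 / 2))"
      by (simp_all only: has_bochner_integral_iff)
  qed (use assms in \<open>auto split: split_indicator\<close>)
  finally show "emeasure (gauss c) (space (gauss c)) \<noteq> \<infinity>"
    by (simp add: ennreal_mult_eq_top_iff)
qed

lemma integral_gauss_bessel_J0:
  assumes "c > 0"
  shows "(\<integral>r. bessel_J 0 (s * r) \<partial>gauss c) = c\<^sup>2 / 2 * exp (- (s * c)\<^sup>2 / 4)"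
proof -
  have "(\<integral>r. bessel_J 0 (s * r) \<partial>gauss c)
      = (\<integral>r. (indicator {0..} r * (r * exp (- (r / c)\<^sup>2))) *\<^sub>R bessel_J 0 (s * r) \<partial>lborel)"
    unfolding gauss_def using gauss_density_nonneg by (intro integral_density) auto
  also have "\<dots> = \<bar>c\<bar> *\<^sub>R (\<integral>u. (indicator {0..} (0 + c * u) * ((0 + c * u) * exp (- ((0 + c * u) / c)\<^sup>2)))
      *\<^sub>R bessel_J 0 (s * (0 + c * u)) \<partial>lborel)"
    using assms by (intro lborel_integral_real_affine) auto
  also have "(\<lambda>u. (indicator {0..} (0 + c * u) * ((0 + c * u) * exp (- ((0 + c * u) / c)\<^sup>2)))
      *\<^sub>R bessel_J 0 (s * (0 + c * u)))
      = (\<lambda>u. c * (indicator {0..} u *\<^sub>R (exp (- u\<^sup>2) * u * bessel_J 0 (s * c * u))))"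
    using assms by (auto simp: fun_eq_iff zero_le_mult_iff mult.assoc split: split_indicator)
  also have "\<bar>c\<bar> *\<^sub>R (\<integral>u. c * (indicator {0..} u *\<^sub>R (exp (- u\<^sup>2) * u * bessel_J 0 (s * c * u))) \<partial>lborel)
      = c * (c * (exp (- (s * c)\<^sup>2 / 4) / 2))"
    using assms by (simp only: integral_mult_right_zero gaussian_moment_bessel_J0) simp
  finally show ?thesis
    by (simp add: power2_eq_square)
qed

section \<open>Angular means of bounded weights\<close>

definition angular_mean :: "(real \<Rightarrow> real) \<Rightarrow> real \<Rightarrow> real" where
  "angular_mean a r = (\<integral>\<alpha>. a \<alpha> * bessel_J 0 (2 * r * sin (\<alpha> / 2)) \<partial>circ)"

text \<open>The bound holds at every point and refers to no measure, so one closure calculus serves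
  \<open>circ\<close> and all the measures \<open>gauss c\<close> at once.\<close>

definition bounded_measurable :: "(real \<Rightarrow> real) \<Rightarrow> bool" where
  "bounded_measurable a \<longleftrightarrow> a \<in> borel_measurable borel \<and> (\<exists>B. \<forall>x. \<bar>a x\<bar> \<le> B)"

lemma bounded_measurable_mult:
  assumes "bounded_measurable a" "bounded_measurable b"
  shows "bounded_measurable (\<lambda>x. a x * b x)"
proof -
  obtain A B where "\<And>x. \<bar>a x\<bar> \<le> A" "\<And>x. \<bar>b x\<bar> \<le> B"
    using assms by (auto simp: bounded_measurable_def)
  then have "\<bar>a x * b x\<bar> \<le> A * B" for x
    unfolding abs_mult by (intro mult_mono) (auto intro: order_trans[OF abs_ge_zero])
  with assms show ?thesis
    by (auto simp: bounded_measurable_def)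
qed

lemma bounded_measurable_add:
  assumes "bounded_measurable a" "bounded_measurable b"
  shows "bounded_measurable (\<lambda>x. a x + b x)"
proof -
  obtain A B where "\<And>x. \<bar>a x\<bar> \<le> A" "\<And>x. \<bar>b x\<bar> \<le> B"
    using assms by (auto simp: bounded_measurable_def)
  then have "\<bar>a x + b x\<bar> \<le> A + B" for x
    by (meson abs_triangle_ineq add_mono order_trans)
  with assms show ?thesis
    by (auto simp: bounded_measurable_def)
qed

lemma bounded_measurable_const: "bounded_measurable (\<lambda>x. c)"
  by (auto simp: bounded_measurable_def)

lemma bounded_measurable_diff:
  assumes "bounded_measurable a" "bounded_measurable b"
  shows "bounded_measurable (\<lambda>x. a x - b x)"
  using bounded_measurable_add[OF assms(1) bounded_measurable_mult[OF bounded_measurable_const assms(2)], of "-1"]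
  by simp

lemma bounded_measurable_power:
  assumes "bounded_measurable a"
  shows "bounded_measurable (\<lambda>x. a x ^ n)"
  by (induction n) (auto intro: bounded_measurable_const bounded_measurable_mult assms)

lemma bounded_measurable_bessel:
  assumes [measurable]: "f \<in> borel_measurable borel"
  shows "bounded_measurable (\<lambda>x. bessel_J 0 (f x))"
  using abs_bessel_J0_le by (auto simp: bounded_measurable_def)

lemmas bounded_measurable_intros = bounded_measurable_mult bounded_measurable_add
  bounded_measurable_const bounded_measurable_diff bounded_measurable_power bounded_measurable_bessel

lemma integrable_bounded_measurable:
  fixes M :: "real measure"
  assumes "finite_measure M" "sets M = sets borel" "bounded_measurable a"
  shows "integrable M a"
proof -
  interpret finite_measure M by fact
  obtain B where "\<And>x. \<bar>a x\<bar> \<le> B"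
    using assms by (auto simp: bounded_measurable_def)
  moreover have "a \<in> borel_measurable M"
    using assms by (auto simp: bounded_measurable_def measurable_cong_sets[OF assms(2) refl])
  ultimately show ?thesis
    by (intro integrable_const_bound[where B = B]) auto
qed

lemma bounded_measurable_angular_mean:
  assumes "bounded_measurable a"
  shows "bounded_measurable (angular_mean a)"
proof -
  obtain B where B: "\<And>x. \<bar>a x\<bar> \<le> B" and [measurable]: "a \<in> borel_measurable borel"
    using assms by (auto simp: bounded_measurable_def)
  have "angular_mean a \<in> borel_measurable borel"
    unfolding angular_mean_def by measurable
  moreover have "\<bar>angular_mean a r\<bar> \<le> B" for r
  proof -
    have int: "integrable circ (\<lambda>\<alpha>. a \<alpha> * bessel_J 0 (2 * r * sin (\<alpha> / 2)))"
      by (intro integrable_bounded_measurable circ.finite_measure_axioms bounded_measurable_intros assms) auto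
    have "\<bar>angular_mean a r\<bar> \<le> (\<integral>\<alpha>. norm (a \<alpha> * bessel_J 0 (2 * r * sin (\<alpha> / 2))) \<partial>circ)"
      unfolding angular_mean_def real_norm_def[symmetric] by (rule integral_norm_bound)
    also have "\<dots> \<le> (\<integral>\<alpha>. B \<partial>circ)"
    proof (intro integral_mono integrable_norm int)
      fix \<alpha>
      show "norm (a \<alpha> * bessel_J 0 (2 * r * sin (\<alpha> / 2))) \<le> B"
        using mult_mono[OF B[of \<alpha>] abs_bessel_J0_le[of "2 * r * sin (\<alpha> / 2)"]] B[of \<alpha>]
        by (simp add: abs_mult)
    qed simp
    finally show ?thesis by simp
  qed
  ultimately show ?thesis
    by (auto simp: bounded_measurable_def)
qed

lemma integrable_angular_mean_kernel:
  assumes "bounded_measurable a"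
  shows "integrable circ (\<lambda>\<alpha>. a \<alpha> * bessel_J 0 (2 * r * sin (\<alpha> / 2)))"
  by (intro integrable_bounded_measurable circ.finite_measure_axioms bounded_measurable_intros assms) auto

lemma angular_mean_add:
  assumes "bounded_measurable a" "bounded_measurable b"
  shows "angular_mean (\<lambda>\<alpha>. a \<alpha> + b \<alpha>) r = angular_mean a r + angular_mean b r"
  using integrable_angular_mean_kernel[OF assms(1)] integrable_angular_mean_kernel[OF assms(2)]
  by (simp add: angular_mean_def distrib_right)

lemma angular_mean_diff:
  assumes "bounded_measurable a" "bounded_measurable b"
  shows "angular_mean (\<lambda>\<alpha>. a \<alpha> - b \<alpha>) r = angular_mean a r - angular_mean b r"
  using integrable_angular_mean_kernel[OF assms(1)] integrable_angular_mean_kernel[OF assms(2)]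
  by (simp add: angular_mean_def left_diff_distrib)

lemma angular_mean_1: "angular_mean (\<lambda>_. 1) r = (bessel_J 0 r)\<^sup>2"
  by (simp add: angular_mean_def bessel_J0_square)

text \<open>The order-zero Hankel transform of h with respect to M is nonnegative. Requiring this at
  every frequency s, and not only at s = 0, makes the property stable under multiplication by
  further angular means.\<close>

definition positive_definite_wrt :: "real measure \<Rightarrow> (real \<Rightarrow> real) \<Rightarrow> bool" where
  "positive_definite_wrt M h \<longleftrightarrow> bounded_measurable h \<and> (\<forall>s. 0 \<le> (\<integral>r. h r * bessel_J 0 (s * r) \<partial>M))"

lemma integrable_pair_bounded:
  fixes f :: "real \<Rightarrow> real \<Rightarrow> real"
  assumes "finite_measure M" "finite_measure N" and [simp, measurable_cong]: "sets M = sets borel" "sets N = sets borel"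
    and meas [measurable]: "case_prod f \<in> borel_measurable (borel \<Otimes>\<^sub>M borel)" and bound: "\<And>x y. \<bar>f x y\<bar> \<le> B"
  shows "integrable (M \<Otimes>\<^sub>M N) (case_prod f)"
proof -
  interpret finite_measure "M \<Otimes>\<^sub>M N"
    by (rule finite_measure_pair_measure) fact+
  show ?thesis
    using bound by (intro integrable_const_bound[where B = B]) auto
qed

lemma Fubini_bounded:
  fixes f :: "real \<Rightarrow> real \<Rightarrow> real"
  assumes fin: "finite_measure M" "finite_measure N" and sets: "sets M = sets borel" "sets N = sets borel"
    and "case_prod f \<in> borel_measurable (borel \<Otimes>\<^sub>M borel)" and "\<And>x y. \<bar>f x y\<bar> \<le> B"
  shows "(\<integral>y. (\<integral>x. f x y \<partial>M) \<partial>N) = (\<integral>x. (\<integral>y. f x y \<partial>N) \<partial>M)"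
proof -
  interpret M: finite_measure M by fact
  interpret N: finite_measure N by fact
  interpret pair_sigma_finite M N by unfold_locales
  show ?thesis
    by (rule Fubini_integral) (rule integrable_pair_bounded; fact)
qed

text \<open>The product formula rewrites two Bessel factors as a mean of single ones at frequencies
  S \<psi>, and each of these has a nonnegative integral by hypothesis.\<close>

lemma positive_definite_wrt_mult_bessel:
  assumes M: "finite_measure M" "sets M = sets borel" and h: "positive_definite_wrt M h"
  shows "0 \<le> (\<integral>r. h r * (bessel_J 0 (t * r) * bessel_J 0 (s * r)) \<partial>M)"
proof -
  obtain B where B: "\<And>x. \<bar>h x\<bar> \<le> B" and [measurable]: "h \<in> borel_measurable borel"
    using h by (auto simp: positive_definite_wrt_def bounded_measurable_def)
  define S where "S \<psi> = sqrt (t\<^sup>2 + s\<^sup>2 - 2 * t * s * cos \<psi>)" for \<psi>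
  have [measurable]: "S \<in> borel_measurable borel"
    unfolding S_def by measurable
  have eq: "bessel_J 0 (t * r) * bessel_J 0 (s * r) = (\<integral>\<psi>. bessel_J 0 (S \<psi> * r) \<partial>circ)" for r
  proof -
    have "(t * r)\<^sup>2 + (s * r)\<^sup>2 - 2 * (t * r) * (s * r) * cos \<psi> = r\<^sup>2 * (t\<^sup>2 + s\<^sup>2 - 2 * t * s * cos \<psi>)" for \<psi>
      by (simp add: power2_eq_square algebra_simps)
    then have "bessel_J 0 (sqrt ((t * r)\<^sup>2 + (s * r)\<^sup>2 - 2 * (t * r) * (s * r) * cos \<psi>)) = bessel_J 0 (\<bar>r\<bar> * S \<psi>)" for \<psi>
      by (simp add: S_def real_sqrt_mult)
    \<comment> \<open>M may charge negative r, where the root of r^2 is the absolute value; evenness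
      of \<open>bessel_J 0\<close> takes care of this.\<close>
    moreover have "bessel_J 0 (\<bar>r\<bar> * S \<psi>) = bessel_J 0 (S \<psi> * r)" for \<psi>
      by (cases "r \<ge> 0") (auto simp: mult.commute)
    ultimately show ?thesis
      by (simp add: bessel_J0_product)
  qed
  have "(\<integral>r. h r * (bessel_J 0 (t * r) * bessel_J 0 (s * r)) \<partial>M)
      = (\<integral>r. (\<integral>\<psi>. h r * bessel_J 0 (S \<psi> * r) \<partial>circ) \<partial>M)"
    by (simp add: eq)
  also have "\<dots> = (\<integral>\<psi>. (\<integral>r. h r * bessel_J 0 (S \<psi> * r) \<partial>M) \<partial>circ)"
  proof (rule Fubini_bounded[symmetric])
    show "\<bar>h r * bessel_J 0 (S \<psi> * r)\<bar> \<le> B" for r \<psi>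
      using mult_mono[OF B[of r] abs_bessel_J0_le[of "S \<psi> * r"]] B[of r] by (simp add: abs_mult)
  qed (use M circ.finite_measure_axioms in \<open>auto\<close>)
  also have "\<dots> \<ge> 0"
    by (rule Bochner_Integration.integral_nonneg) (use h in \<open>auto simp: positive_definite_wrt_def\<close>)
  finally show ?thesis .
qed

text \<open>An angular mean with nonnegative weight is a nonnegative superposition of the functions
  \<open>bessel_J 0 (2 * sin (\<alpha> / 2) * r)\<close>, so the case of one Bessel factor is
  integrated over \<alpha>.\<close>

lemma positive_definite_wrt_mult_angular_mean:
  assumes M: "finite_measure M" "sets M = sets borel" and h: "positive_definite_wrt M h"
    and a: "bounded_measurable a" "\<And>\<alpha>. 0 \<le> a \<alpha>"
  shows "positive_definite_wrt M (\<lambda>r. h r * angular_mean a r)"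
  unfolding positive_definite_wrt_def
proof (intro conjI allI)
  obtain B where B: "\<And>x. \<bar>h x\<bar> \<le> B" and [measurable]: "h \<in> borel_measurable borel"
    using h by (auto simp: positive_definite_wrt_def bounded_measurable_def)
  obtain A where A: "\<And>x. \<bar>a x\<bar> \<le> A" and [measurable]: "a \<in> borel_measurable borel"
    using a by (auto simp: bounded_measurable_def)
  show "bounded_measurable (\<lambda>r. h r * angular_mean a r)"
    using h a by (intro bounded_measurable_mult bounded_measurable_angular_mean) (auto simp: positive_definite_wrt_def)
  fix s
  define k where "k r \<alpha> = a \<alpha> * (h r * (bessel_J 0 (2 * sin (\<alpha> / 2) * r) * bessel_J 0 (s * r)))" for r \<alpha>
  have "h r * angular_mean a r * bessel_J 0 (s * r) = (\<integral>\<alpha>. k r \<alpha> \<partial>circ)" for r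
  proof -
    have "k r \<alpha> = h r * bessel_J 0 (s * r) * (a \<alpha> * bessel_J 0 (2 * r * sin (\<alpha> / 2)))" for \<alpha>
      by (simp add: k_def mult_ac)
    then show ?thesis
      by (simp add: angular_mean_def)
  qed
  then have "(\<integral>r. h r * angular_mean a r * bessel_J 0 (s * r) \<partial>M) = (\<integral>r. (\<integral>\<alpha>. k r \<alpha> \<partial>circ) \<partial>M)"
    by simp
  also have "\<dots> = (\<integral>\<alpha>. (\<integral>r. k r \<alpha> \<partial>M) \<partial>circ)"
  proof (rule Fubini_bounded[symmetric])
    show "\<bar>k r \<alpha>\<bar> \<le> A * (B * (1 * 1))" for r \<alpha>
      unfolding k_def abs_mult
      by (intro mult_mono A B abs_bessel_J0_le) (auto intro: order_trans[OF abs_ge_zero A] order_trans[OF abs_ge_zero B])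
    show "case_prod k \<in> borel_measurable (borel \<Otimes>\<^sub>M borel)"
      unfolding k_def[abs_def] by measurable
  qed (use M circ.finite_measure_axioms in \<open>auto\<close>)
  also have "\<dots> \<ge> 0"
    unfolding k_def
    by (rule Bochner_Integration.integral_nonneg)
       (use positive_definite_wrt_mult_bessel[OF M h] a(2) in simp)
  finally show "0 \<le> (\<integral>r. h r * angular_mean a r * bessel_J 0 (s * r) \<partial>M)" .
qed

lemma positive_definite_wrt_gauss_1: "c > 0 \<Longrightarrow> positive_definite_wrt (gauss c) (\<lambda>_. 1)"
  by (auto simp: positive_definite_wrt_def integral_gauss_bessel_J0 intro: bounded_measurable_const)

text \<open>Starting from the constant 1, which is the positivity of the Gaussian transform, the
  three factors are multiplied on one at a time; frequency s = 0, where the kernel is 1, gives the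
  plain integral. This yields monotonicity of the trilinear form in each nonnegative
  argument.\<close>

lemma integral_gauss_triple_nonneg:
  assumes c: "c > 0"
    and a: "bounded_measurable a1" "bounded_measurable a2" "bounded_measurable a3"
    and nonneg: "\<And>\<alpha>. 0 \<le> a1 \<alpha>" "\<And>\<alpha>. 0 \<le> a2 \<alpha>" "\<And>\<alpha>. 0 \<le> a3 \<alpha>"
  shows "0 \<le> (\<integral>r. angular_mean a1 r * angular_mean a2 r * angular_mean a3 r \<partial>gauss c)"
proof -
  note step = positive_definite_wrt_mult_angular_mean[OF finite_measure_gauss[OF c] sets_gauss]
  have "positive_definite_wrt (gauss c) (\<lambda>r. 1 * angular_mean a1 r * angular_mean a2 r * angular_mean a3 r)"
    using a nonneg by (intro step positive_definite_wrt_gauss_1 c)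
  then have "0 \<le> (\<integral>r. 1 * angular_mean a1 r * angular_mean a2 r * angular_mean a3 r * bessel_J 0 (0 * r) \<partial>gauss c)"
    unfolding positive_definite_wrt_def by blast
  then show ?thesis
    by simp
qed

section \<open>The deficit of cubes\<close>

text \<open>With \<open>p = J\<^sub>0\<^sup>2\<close>, \<open>q\<close> the mean of \<open>u\<close> and \<open>h\<close> that of \<open>(1 - u\<^sup>2) / 2\<close>, the difference of cubes is
  \<open>p\<^sup>3 - q\<^sup>3 = 3/4 (p + q)\<^sup>2 (p - q) + 1/4 (p - q)\<^sup>3\<close>; the means of \<open>1 + u\<close> and \<open>1 - u\<close>
  are \<open>p + q\<close> and \<open>p - q\<close>, and both \<open>1 + u\<close> and \<open>1 - u\<close> dominate \<open>(1 - u\<^sup>2) / 2\<close>, so that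
  two of the factors can be traded for \<open>h\<close> without increasing the integral.\<close>

lemma integral_gauss_cube_deficit:
  fixes u :: "real \<Rightarrow> real"
  defines "p \<equiv> \<lambda>r. (bessel_J 0 r)\<^sup>2" and "q \<equiv> angular_mean u"
    and "h \<equiv> angular_mean (\<lambda>\<alpha>. (1 - (u \<alpha>)\<^sup>2) / 2)"
  assumes c: "c > 0" and u [measurable]: "u \<in> borel_measurable borel" and u_le: "\<And>\<alpha>. \<bar>u \<alpha>\<bar> \<le> 1"
    and q_nonneg: "\<And>r. 0 \<le> q r"
  shows "(\<integral>r. q r ^ 3 + 3 / 4 * (h r)\<^sup>2 * p r \<partial>gauss c) \<le> (\<integral>r. p r ^ 3 \<partial>gauss c)"
proof -
  define k where "k \<alpha> = (1 - (u \<alpha>)\<^sup>2) / 2" for \<alpha>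
  have bu: "bounded_measurable u"
    using u_le by (auto simp: bounded_measurable_def)
  have bk: "bounded_measurable k"
    using bounded_measurable_mult[OF bounded_measurable_const[of "1 / 2"]
        bounded_measurable_diff[OF bounded_measurable_const[of 1] bounded_measurable_power[OF bu, of 2]]]
    by (simp add: k_def[abs_def])
  have b1: "bounded_measurable (\<lambda>_. 1)"
    by (rule bounded_measurable_const)
  note bs = bu bk b1 bounded_measurable_add bounded_measurable_diff
  have p: "p r = angular_mean (\<lambda>_. 1) r" for r
    by (simp add: p_def angular_mean_1)
  have h: "h = angular_mean k"
    by (simp add: h_def k_def[abs_def])
  have u_bounds: "-1 \<le> u \<alpha>" "u \<alpha> \<le> 1" for \<alpha>
    using u_le[of \<alpha>] by auto
  have plus_nonneg: "0 \<le> 1 + u \<alpha>" and minus_nonneg: "0 \<le> 1 - u \<alpha>" for \<alpha>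
    using u_bounds[of \<alpha>] by auto
  have u_sq: "(u \<alpha>)\<^sup>2 \<le> 1" for \<alpha>
    using u_le[of \<alpha>] by (simp add: abs_square_le_1)
  have k_nonneg: "0 \<le> k \<alpha>" for \<alpha>
    using u_sq[of \<alpha>] by (simp add: k_def)
  have plus: "angular_mean (\<lambda>\<alpha>. 1 + u \<alpha>) r = p r + q r" for r
    by (simp add: angular_mean_add bs p q_def)
  have minus: "angular_mean (\<lambda>\<alpha>. 1 - u \<alpha>) r = p r - q r" for r
    by (simp add: angular_mean_diff bs p q_def)
  have plus_k: "angular_mean (\<lambda>\<alpha>. (1 + u \<alpha>) - k \<alpha>) r = p r + q r - h r" for r
    by (simp add: angular_mean_diff[of "\<lambda>\<alpha>. 1 + u \<alpha>"] bs plus h)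
  have minus_k: "angular_mean (\<lambda>\<alpha>. (1 - u \<alpha>) - k \<alpha>) r = p r - q r - h r" for r
    by (simp add: angular_mean_diff[of "\<lambda>\<alpha>. 1 - u \<alpha>"] bs minus h)
  have plus_k_nonneg: "0 \<le> (1 + u \<alpha>) - k \<alpha>" for \<alpha>
  proof -
    have "(1 + u \<alpha>) - k \<alpha> = (1 + u \<alpha>)\<^sup>2 / 2"
      by (simp add: k_def power2_eq_square field_simps)
    then show ?thesis
      using zero_le_power2[of "1 + u \<alpha>"] by linarith
  qed
  have minus_k_nonneg: "0 \<le> (1 - u \<alpha>) - k \<alpha>" for \<alpha>
  proof -
    have "(1 - u \<alpha>) - k \<alpha> = (1 - u \<alpha>)\<^sup>2 / 2"
      by (simp add: k_def power2_eq_square field_simps)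
    then show ?thesis
      using zero_le_power2[of "1 - u \<alpha>"] by linarith
  qed
  have I1: "0 \<le> (\<integral>r. (p r + q r) * (p r + q r) * (p r - q r - h r) \<partial>gauss c)"
    unfolding plus[symmetric] minus_k[symmetric]
    by (intro integral_gauss_triple_nonneg c bs plus_nonneg minus_k_nonneg)
  have I2: "0 \<le> (\<integral>r. (p r + q r) * (p r + q r - h r) * h r \<partial>gauss c)"
  proof -
    have "0 \<le> (\<integral>r. angular_mean (\<lambda>\<alpha>. 1 + u \<alpha>) r * angular_mean (\<lambda>\<alpha>. 1 + u \<alpha> - k \<alpha>) r * angular_mean k r \<partial>gauss c)"
      by (intro integral_gauss_triple_nonneg c bs plus_nonneg plus_k_nonneg k_nonneg)
    then show ?thesis
      by (simp only: plus plus_k h)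
  qed
  have I3: "0 \<le> (\<integral>r. (p r - q r) * (p r - q r) * (p r - q r) \<partial>gauss c)"
    unfolding minus[symmetric]
    by (intro integral_gauss_triple_nonneg c bs minus_nonneg)
  \<comment> \<open>Unlike the other three, this sign is pointwise and does not come from positive
    definiteness; it uses the sign of q.\<close>
  have I4: "0 \<le> (\<integral>r. q r * (h r)\<^sup>2 \<partial>gauss c)"
    using q_nonneg by (intro Bochner_Integration.integral_nonneg) auto
  have bp: "bounded_measurable p" and bq: "bounded_measurable q" and bh: "bounded_measurable h"
    unfolding q_def h p_def
    by (intro bounded_measurable_angular_mean bounded_measurable_power bounded_measurable_bessel bs; simp)+
  have int: "integrable (gauss c) f" if "bounded_measurable f" for f
    using that by (intro integrable_bounded_measurable finite_measure_gauss c sets_gauss)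
  note bi = bounded_measurable_mult bounded_measurable_add bounded_measurable_diff
      bounded_measurable_const bounded_measurable_power bp bq bh
  \<comment> \<open>The h terms telescope: the first two lines together give 3/4 (p + q)^2 (p - q) -
    3/4 (p + q) h^2. The last term restores 3/4 q h^2, so exactly 3/4 p h^2 is left as deficit. The
    explicit factor p is positive near r = 0, which the case of equality exploits.\<close>
  define d where "d r = 3 / 4 * ((p r + q r) * (p r + q r) * (p r - q r - h r))
    + 3 / 4 * ((p r + q r) * (p r + q r - h r) * h r)
    + 1 / 4 * ((p r - q r) * (p r - q r) * (p r - q r)) + 3 / 4 * (q r * (h r)\<^sup>2)" for r
  have bd: "bounded_measurable d"
    unfolding d_def[abs_def] by (intro bi)
  have "(\<integral>r. d r \<partial>gauss c) = 3 / 4 * (\<integral>r. (p r + q r) * (p r + q r) * (p r - q r - h r) \<partial>gauss c)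
    + 3 / 4 * (\<integral>r. (p r + q r) * (p r + q r - h r) * h r \<partial>gauss c)
    + 1 / 4 * (\<integral>r. (p r - q r) * (p r - q r) * (p r - q r) \<partial>gauss c)
    + 3 / 4 * (\<integral>r. q r * (h r)\<^sup>2 \<partial>gauss c)"
    unfolding d_def
    by (subst Bochner_Integration.integral_add; (intro int bi)?)+ (simp only: integral_mult_right_zero)
  then have "0 \<le> (\<integral>r. d r \<partial>gauss c)"
    using I1 I2 I3 I4 by simp
  moreover have "p r ^ 3 = (q r ^ 3 + 3 / 4 * (h r)\<^sup>2 * p r) + d r" for r
    by (simp add: d_def power2_eq_square power3_eq_cube algebra_simps)
  then have "(\<integral>r. p r ^ 3 \<partial>gauss c) = (\<integral>r. q r ^ 3 + 3 / 4 * (h r)\<^sup>2 * p r \<partial>gauss c) + (\<integral>r. d r \<partial>gauss c)"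
    by (simp only:) (intro Bochner_Integration.integral_add int bi bd)
  ultimately show ?thesis
    by simp
qed

lemma nn_integral_gauss:
  assumes [measurable]: "f \<in> borel_measurable borel"
  shows "(\<integral>\<^sup>+r. f r \<partial>gauss c) = (\<integral>\<^sup>+r. ennreal (indicator {0..} r * (r * exp (- (r / c)\<^sup>2))) * f r \<partial>lborel)"
  unfolding gauss_def by (rule nn_integral_density) auto

text \<open>Removal of the Gaussian cutoff. For each scale the damped integral is at most the damped
  integral of the sixth power of \<open>bessel_J 0\<close>, hence at most \<open>I000\<close>
  uniformly in n. The integrand F is nonnegative because q is, so Fatou's lemma applies.\<close>

lemma radial_cube_deficit:
  fixes u :: "real \<Rightarrow> real"
  defines "q \<equiv> angular_mean u" and "h \<equiv> angular_mean (\<lambda>\<alpha>. (1 - (u \<alpha>)\<^sup>2) / 2)"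
  assumes u [measurable]: "u \<in> borel_measurable borel" and u_le: "\<And>\<alpha>. \<bar>u \<alpha>\<bar> \<le> 1"
    and q_nonneg: "\<And>r. 0 \<le> q r"
  shows "(\<integral>\<^sup>+r. ennreal (indicator {0..} r * (r * (q r ^ 3 + 3 / 4 * (h r)\<^sup>2 * (bessel_J 0 r)\<^sup>2))) \<partial>lborel)
    \<le> ennreal I000"
proof -
  define F where "F r = q r ^ 3 + 3 / 4 * (h r)\<^sup>2 * (bessel_J 0 r)\<^sup>2" for r
  define w where "w n r = indicator {0..} r * (r * exp (- (r / real (Suc n))\<^sup>2))" for n and r :: real
  have bu: "bounded_measurable u"
    using u_le by (auto simp: bounded_measurable_def)
  have bk: "bounded_measurable (\<lambda>\<alpha>. (1 - (u \<alpha>)\<^sup>2) / 2)"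
    using bounded_measurable_mult[OF bounded_measurable_const[of "1 / 2"]
        bounded_measurable_diff[OF bounded_measurable_const[of 1] bounded_measurable_power[OF bu, of 2]]]
    by simp
  have bF: "bounded_measurable F"
    unfolding F_def[abs_def] q_def h_def using bu bk
    by (intro bounded_measurable_intros bounded_measurable_angular_mean) auto
  have [measurable]: "F \<in> borel_measurable borel"
    using bF by (simp add: bounded_measurable_def)
  have F_nonneg: "0 \<le> F r" for r
    using q_nonneg[of r] by (simp add: F_def)
  have w_nonneg: "0 \<le> w n r" for n r
    by (simp add: w_def split: split_indicator)
  have bound: "(\<integral>\<^sup>+r. ennreal (w n r * F r) \<partial>lborel) \<le> ennreal I000" for n
  proof -
    define c where "c = real (Suc n)"
    have c: "c > 0" by (simp add: c_def)
    have int: "integrable (gauss c) f" if "bounded_measurable f" for f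
      using that by (intro integrable_bounded_measurable finite_measure_gauss c sets_gauss)
    have bJ: "bounded_measurable (\<lambda>r. ((bessel_J 0 r)\<^sup>2) ^ 3)"
      by (intro bounded_measurable_power bounded_measurable_bessel) auto
    have "(\<integral>\<^sup>+r. ennreal (w n r * F r) \<partial>lborel) = (\<integral>\<^sup>+r. ennreal (F r) \<partial>gauss c)"
      using w_nonneg[of n] F_nonneg
      by (subst nn_integral_gauss) (auto simp: w_def c_def ennreal_mult' intro!: nn_integral_cong)
    also have "\<dots> = ennreal (\<integral>r. F r \<partial>gauss c)"
      using F_nonneg by (intro nn_integral_eq_integral int bF) auto
    also have "\<dots> \<le> ennreal (\<integral>r. ((bessel_J 0 r)\<^sup>2) ^ 3 \<partial>gauss c)"
      unfolding F_def q_def h_def using q_nonneg u_le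
      by (intro ennreal_leI integral_gauss_cube_deficit c u) (auto simp: q_def)
    also have "\<dots> = (\<integral>\<^sup>+r. ennreal (((bessel_J 0 r)\<^sup>2) ^ 3) \<partial>gauss c)"
      by (intro nn_integral_eq_integral[symmetric] int bJ) auto
    also have "\<dots> = (\<integral>\<^sup>+r. ennreal (w n r * bessel_J 0 r ^ 6) \<partial>lborel)"
      using w_nonneg[of n]
      by (subst nn_integral_gauss) (auto simp: w_def c_def ennreal_mult' simp flip: power_mult intro!: nn_integral_cong)
    also have "\<dots> \<le> (\<integral>\<^sup>+r. ennreal (indicator {0..} r * (r * bessel_J 0 r ^ 6)) \<partial>lborel)"
    proof (intro nn_integral_mono ennreal_leI)
      fix r :: real
      have "r * exp (- (r / real (Suc n))\<^sup>2) * bessel_J 0 r ^ 6 \<le> r * 1 * bessel_J 0 r ^ 6" if "0 \<le> r"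
        using that by (intro mult_right_mono mult_left_mono) (auto simp: zero_le_even_power)
      then show "w n r * bessel_J 0 r ^ 6 \<le> indicator {0..} r * (r * bessel_J 0 r ^ 6)"
        by (simp add: w_def split: split_indicator)
    qed
    finally show ?thesis
      by (simp only: nn_integral_J0_power6)
  qed
  have lim: "(\<lambda>n. ennreal (w n r * F r)) \<longlonglongrightarrow> ennreal (indicator {0..} r * (r * F r))" for r
  proof -
    have "(\<lambda>n. r / real (Suc n)) \<longlonglongrightarrow> 0"
      by (rule LIMSEQ_Suc[OF lim_const_over_n])
    then have "(\<lambda>n. w n r * F r) \<longlonglongrightarrow> indicator {0..} r * (r * exp (- (0\<^sup>2))) * F r"
      unfolding w_def by (intro tendsto_intros)
    then show ?thesis
      by (simp add: mult.assoc)
  qed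
  have "(\<integral>\<^sup>+r. ennreal (indicator {0..} r * (r * F r)) \<partial>lborel) = (\<integral>\<^sup>+r. liminf (\<lambda>n. ennreal (w n r * F r)) \<partial>lborel)"
    by (intro nn_integral_cong lim_imp_Liminf[symmetric] lim) auto
  also have "\<dots> \<le> liminf (\<lambda>n. \<integral>\<^sup>+r. ennreal (w n r * F r) \<partial>lborel)"
    unfolding w_def by (intro nn_integral_liminf) auto
  also have "\<dots> \<le> ennreal I000"
    using bound by (intro Liminf_le) auto
  finally show ?thesis
    unfolding F_def .
qed

section \<open>The angular mean of the extension\<close>

lemma cnj_measurable [measurable]: "cnj \<in> borel_measurable borel"
  by (intro borel_measurable_continuous_onI continuous_intros)

lemma cis_measurable [measurable]: "cis \<in> borel_measurable borel"
  unfolding cis_conv_exp[abs_def] by (intro borel_measurable_continuous_onI continuous_intros)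

lemma Fubini_circ:
  fixes F :: "real \<Rightarrow> real \<Rightarrow> complex"
  assumes [measurable]: "case_prod F \<in> borel_measurable (borel \<Otimes>\<^sub>M borel)"
    and int: "\<And>x. integrable circ (F x)" "integrable circ (\<lambda>x. \<integral>y. norm (F x y) \<partial>circ)"
  shows "(\<integral>y. (\<integral>x. F x y \<partial>circ) \<partial>circ) = (\<integral>x. (\<integral>y. F x y \<partial>circ) \<partial>circ)"
proof -
  interpret pair_sigma_finite circ circ by (rule circ_pair_sigma_finite)
  have "integrable (circ \<Otimes>\<^sub>M circ) (case_prod F)"
    using int by (intro Fubini_integrable) auto
  then show ?thesis
    by (rule Fubini_integral)
qed

text \<open>A square integrable function on the circle need not be bounded, so the exchange on
  finite measures with a constant bound does not apply; a majorant of product form replaces the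
  bound.\<close>

lemma Fubini_circ_dominated:
  fixes F :: "real \<Rightarrow> real \<Rightarrow> complex" and A B :: "real \<Rightarrow> real"
  assumes F [measurable]: "case_prod F \<in> borel_measurable (borel \<Otimes>\<^sub>M borel)"
    and bound: "\<And>x y. norm (F x y) \<le> A x * B y" and A: "integrable circ A" and B: "integrable circ B"
  shows "(\<integral>y. (\<integral>x. F x y \<partial>circ) \<partial>circ) = (\<integral>x. (\<integral>y. F x y \<partial>circ) \<partial>circ)"
proof -
  have int: "integrable circ (F x)" for x
  proof (rule Bochner_Integration.integrable_bound)
    show "integrable circ (\<lambda>y. A x * B y)"
      using B by simp
    show "AE y in circ. norm (F x y) \<le> norm (A x * B y)"
      using order_trans[OF bound abs_ge_self] by simp
  qed measurable
  have "integrable circ (\<lambda>x. \<integral>y. norm (F x y) \<partial>circ)"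
  proof (rule Bochner_Integration.integrable_bound)
    show "integrable circ (\<lambda>x. A x * (\<integral>y. B y \<partial>circ))"
      using A by simp
    have "(\<integral>y. norm (F x y) \<partial>circ) \<le> (\<integral>y. A x * B y \<partial>circ)" for x
      using bound B int by (intro integral_mono integrable_norm) auto
    moreover have "0 \<le> (\<integral>y. norm (F x y) \<partial>circ)" for x
      by (rule Bochner_Integration.integral_nonneg) simp
    ultimately show "AE x in circ. norm (\<integral>y. norm (F x y) \<partial>circ) \<le> norm (A x * (\<integral>y. B y \<partial>circ))"
      by (intro AE_I2) (simp add: order_trans[OF _ abs_ge_self])
  qed measurable
  with F int show ?thesis
    by (rule Fubini_circ)
qed

section \<open>Energy, correlation and amplitude of a periodic function\<close>

locale periodic_L2 =
  fixes g :: "real \<Rightarrow> complex"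
  assumes g_measurable [measurable]: "g \<in> borel_measurable borel"
    and periodic: "g (t + 2 * pi) = g t"
    and square_integrable: "integrable circ (\<lambda>t. (cmod (g t))\<^sup>2)"
begin

definition energy :: real where
  "energy = (\<integral>t. (cmod (g t))\<^sup>2 \<partial>circ)"

text \<open>Only the real part of the autocorrelation is kept: it is paired with a real kernel and
  the result is a real norm, so the imaginary part contributes nothing. Real values allow the order
  arguments of the cube deficit.\<close>

definition correlation :: "real \<Rightarrow> real" where
  "correlation \<alpha> = Re (\<integral>s. g (s + \<alpha>) * cnj (g s) \<partial>circ)"

text \<open>The extension of g at the point with polar coordinates (r, \<phi>).\<close>

definition amplitude :: "real \<Rightarrow> real \<Rightarrow> complex" where
  "amplitude r \<phi> = (\<integral>t. g t * cis (- r * cos (t - \<phi>)) \<partial>circ)"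

lemma energy_nonneg: "0 \<le> energy"
  unfolding energy_def by (rule Bochner_Integration.integral_nonneg) simp

lemma integrable_norm_g: "integrable circ (\<lambda>t. cmod (g t))"
proof (rule Bochner_Integration.integrable_bound)
  show "integrable circ (\<lambda>t. 1 + (cmod (g t))\<^sup>2)"
    using square_integrable by simp
  have "x \<le> 1 + x\<^sup>2" for x :: real
    using zero_le_power2[of "x - 1 / 2"] by (simp add: power2_eq_square algebra_simps)
  then show "AE t in circ. norm (cmod (g t)) \<le> norm (1 + (cmod (g t))\<^sup>2)"
    by (intro AE_I2) (simp add: abs_of_nonneg add_nonneg_nonneg)
qed measurable

lemma integrable_g: "integrable circ g"
  using integrable_norm_g by (rule integrable_norm_cancel) measurable

lemma
  shows square_integrable_shift: "integrable circ (\<lambda>s. (cmod (g (s + \<alpha>)))\<^sup>2)"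
    and energy_shift: "(\<integral>s. (cmod (g (s + \<alpha>)))\<^sup>2 \<partial>circ) = energy"
  unfolding energy_def
  using integrable_circ_shift[of "\<lambda>s. (cmod (g s))\<^sup>2"] integral_circ_shift[of "\<lambda>s. (cmod (g s))\<^sup>2"]
  by (simp_all add: periodic square_integrable)

lemma norm_mult_le: "cmod (z * cnj w) \<le> ((cmod z)\<^sup>2 + (cmod w)\<^sup>2) / 2"
  using zero_le_power2[of "cmod z - cmod w"]
  by (simp add: norm_mult power2_eq_square algebra_simps)

lemma integrable_correlation: "integrable circ (\<lambda>s. g (s + \<alpha>) * cnj (g s))"
proof (rule Bochner_Integration.integrable_bound)
  show "integrable circ (\<lambda>s. ((cmod (g (s + \<alpha>)))\<^sup>2 + (cmod (g s))\<^sup>2) / 2)"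
    using square_integrable_shift square_integrable by simp
  show "AE s in circ. norm (g (s + \<alpha>) * cnj (g s)) \<le> norm (((cmod (g (s + \<alpha>)))\<^sup>2 + (cmod (g s))\<^sup>2) / 2)"
    using norm_mult_le by (intro AE_I2) (simp add: add_nonneg_nonneg)
qed measurable

lemma correlation_eq: "correlation \<alpha> = (\<integral>s. Re (g (s + \<alpha>) * cnj (g s)) \<partial>circ)"
  unfolding correlation_def by (rule integral_Re[OF integrable_correlation, symmetric])

lemma correlation_measurable [measurable]: "correlation \<in> borel_measurable borel"
  unfolding correlation_def by measurable

text \<open>These identities serve twice: nonnegativity of the left-hand sides bounds the
  correlation by the energy, and their vanishing says that a shift maps g to g or to - g.\<close>

lemma
  shows integral_norm_diff_square: "(\<integral>s. (cmod (g (s + \<alpha>) - g s))\<^sup>2 \<partial>circ) = 2 * energy - 2 * correlation \<alpha>"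
    and integral_norm_sum_square: "(\<integral>s. (cmod (g (s + \<alpha>) + g s))\<^sup>2 \<partial>circ) = 2 * energy + 2 * correlation \<alpha>"
    and integrable_norm_diff_square: "integrable circ (\<lambda>s. (cmod (g (s + \<alpha>) - g s))\<^sup>2)"
    and integrable_norm_sum_square: "integrable circ (\<lambda>s. (cmod (g (s + \<alpha>) + g s))\<^sup>2)"
proof -
  have diff: "(cmod (z - w))\<^sup>2 = (cmod z)\<^sup>2 + (cmod w)\<^sup>2 - 2 * Re (z * cnj w)"
    and sum: "(cmod (z + w))\<^sup>2 = (cmod z)\<^sup>2 + (cmod w)\<^sup>2 + 2 * Re (z * cnj w)" for z w
    unfolding cmod_power2 by (simp_all add: power2_eq_square algebra_simps)
  have int: "integrable circ (\<lambda>s. Re (g (s + \<alpha>) * cnj (g s)))"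
    using integrable_correlation by (rule integrable_Re)
  note ints = int square_integrable_shift square_integrable
  show "(\<integral>s. (cmod (g (s + \<alpha>) - g s))\<^sup>2 \<partial>circ) = 2 * energy - 2 * correlation \<alpha>"
    unfolding diff correlation_eq using ints by (simp del: times_complex.sel add: energy_shift flip: energy_def)
  show "(\<integral>s. (cmod (g (s + \<alpha>) + g s))\<^sup>2 \<partial>circ) = 2 * energy + 2 * correlation \<alpha>"
    unfolding sum correlation_eq using ints by (simp del: times_complex.sel add: energy_shift flip: energy_def)
  show "integrable circ (\<lambda>s. (cmod (g (s + \<alpha>) - g s))\<^sup>2)" "integrable circ (\<lambda>s. (cmod (g (s + \<alpha>) + g s))\<^sup>2)"
    unfolding diff sum using ints by (simp_all del: times_complex.sel)
qed

lemma abs_correlation_le: "\<bar>correlation \<alpha>\<bar> \<le> energy"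
proof -
  have "0 \<le> (\<integral>s. (cmod (g (s + \<alpha>) - g s))\<^sup>2 \<partial>circ)" "0 \<le> (\<integral>s. (cmod (g (s + \<alpha>) + g s))\<^sup>2 \<partial>circ)"
    by (rule Bochner_Integration.integral_nonneg; simp)+
  then show ?thesis
    by (simp add: integral_norm_diff_square integral_norm_sum_square)
qed

lemma amplitude_measurable [measurable]: "amplitude r \<in> borel_measurable borel"
  unfolding amplitude_def by measurable

lemma integrable_amplitude_kernel: "integrable circ (\<lambda>t. g t * cis (- r * cos (t - \<phi>)))"
  by (rule Bochner_Integration.integrable_bound[OF integrable_g]) (auto simp: norm_mult)

lemma norm_amplitude_le: "cmod (amplitude r \<phi>) \<le> (\<integral>t. cmod (g t) \<partial>circ)"
proof -
  have "cmod (amplitude r \<phi>) \<le> (\<integral>t. cmod (g t * cis (- r * cos (t - \<phi>))) \<partial>circ)"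
    unfolding amplitude_def by (rule integral_norm_bound)
  then show ?thesis
    by (simp add: norm_mult)
qed

text \<open>The squared modulus is a double integral over frequencies s and t. Averaging over \<phi>
  first leaves the Bessel function of r times the chord between them; with t = s + \<alpha> that
  factor depends on \<alpha> alone, and the remaining integral over s is the
  autocorrelation.\<close>

lemma integral_norm_amplitude_square:
  "(\<integral>\<phi>. (cmod (amplitude r \<phi>))\<^sup>2 \<partial>circ) = angular_mean correlation r"
proof -
  define X where "X s \<phi> t = cnj (g s) * cis (r * cos (s - \<phi>)) * (g t * cis (- r * cos (t - \<phi>)))" for s \<phi> t
  define C where "C = (\<integral>t. cmod (g t) \<partial>circ)"
  define J where "J \<alpha> = complex_of_real (bessel_J 0 (2 * r * sin (\<alpha> / 2)))" for \<alpha>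
  have [measurable]: "J \<in> borel_measurable borel"
    unfolding J_def by measurable
  have J_le: "norm (J \<alpha>) \<le> 1" for \<alpha>
    by (simp add: J_def abs_bessel_J0_le)
  have X: "(\<integral>t. X s \<phi> t \<partial>circ) = cnj (g s) * cis (r * cos (s - \<phi>)) * amplitude r \<phi>" for s \<phi>
    unfolding X_def amplitude_def by (rule integral_mult_right_zero)
  have "complex_of_real ((cmod z)\<^sup>2) = cnj z * z" for z
    by (simp only: complex_norm_square mult.commute)
  then have "complex_of_real (\<integral>\<phi>. (cmod (amplitude r \<phi>))\<^sup>2 \<partial>circ)
      = (\<integral>\<phi>. cnj (amplitude r \<phi>) * amplitude r \<phi> \<partial>circ)"
    by (simp only: integral_complex_of_real[symmetric])
  also have "\<dots> = (\<integral>\<phi>. (\<integral>s. (\<integral>t. X s \<phi> t \<partial>circ) \<partial>circ) \<partial>circ)"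
  proof (intro Bochner_Integration.integral_cong refl)
    fix \<phi>
    have "cnj (amplitude r \<phi>) = (\<integral>s. cnj (g s * cis (- r * cos (s - \<phi>))) \<partial>circ)"
      unfolding amplitude_def by (rule integral_bounded_linear[OF bounded_linear_cnj integrable_amplitude_kernel, symmetric])
    then show "cnj (amplitude r \<phi>) * amplitude r \<phi> = (\<integral>s. (\<integral>t. X s \<phi> t \<partial>circ) \<partial>circ)"
      unfolding X by (simp add: cis_cnj)
  qed
  \<comment> \<open>The \<phi> integral is moved to the innermost place in two exchanges, first past
    s and then, for fixed s, past t.\<close>
  also have "\<dots> = (\<integral>s. (\<integral>\<phi>. (\<integral>t. X s \<phi> t \<partial>circ) \<partial>circ) \<partial>circ)"
    unfolding X
  proof (rule Fubini_circ_dominated[where A = "\<lambda>s. cmod (g s)" and B = "\<lambda>_. C"])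
    show "norm (cnj (g s) * cis (r * cos (s - \<phi>)) * amplitude r \<phi>) \<le> cmod (g s) * C" for s \<phi>
      using norm_amplitude_le[of r \<phi>] by (simp add: norm_mult C_def mult_left_mono)
  qed (simp_all add: integrable_norm_g, measurable)
  also have "\<dots> = (\<integral>s. (\<integral>t. (\<integral>\<phi>. X s \<phi> t \<partial>circ) \<partial>circ) \<partial>circ)"
  proof (rule Bochner_Integration.integral_cong[OF refl])
    fix s
    have "case_prod (X s) \<in> borel_measurable (borel \<Otimes>\<^sub>M borel)"
      unfolding X_def[abs_def] by measurable
    moreover have "norm (X s \<phi> t) \<le> cmod (g s) * cmod (g t)" for \<phi> t
      by (simp add: X_def norm_mult)
    ultimately have "(\<integral>t. (\<integral>\<phi>. X s \<phi> t \<partial>circ) \<partial>circ) = (\<integral>\<phi>. (\<integral>t. X s \<phi> t \<partial>circ) \<partial>circ)"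
      by (rule Fubini_circ_dominated) (simp_all add: integrable_norm_g)
    then show "(\<integral>\<phi>. (\<integral>t. X s \<phi> t \<partial>circ) \<partial>circ) = (\<integral>t. (\<integral>\<phi>. X s \<phi> t \<partial>circ) \<partial>circ)"
      by simp
  qed
  also have "\<dots> = (\<integral>s. (\<integral>t. cnj (g s) * g t * J (t - s) \<partial>circ) \<partial>circ)"
  proof (intro Bochner_Integration.integral_cong refl)
    fix s t
    have "(r * (a - b))\<^sup>2 + (r * (c - d))\<^sup>2
        = r\<^sup>2 * ((c\<^sup>2 + a\<^sup>2) + (d\<^sup>2 + b\<^sup>2) - 2 * (b * a + d * c))" for a b c d
      by (simp add: power2_eq_square algebra_simps)
    then have "(r * (cos s - cos t))\<^sup>2 + (r * (sin s - sin t))\<^sup>2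
        = r\<^sup>2 * (((sin s)\<^sup>2 + (cos s)\<^sup>2) + ((sin t)\<^sup>2 + (cos t)\<^sup>2) - 2 * (cos t * cos s + sin t * sin s))"
      by this
    also have "\<dots> = r\<^sup>2 * (2 - 2 * cos (t - s))"
      by (simp add: cos_diff)
    also have "cos (t - s) = 1 - 2 * (sin ((t - s) / 2))\<^sup>2"
    proof -
      have "cos x = 1 - 2 * (sin (x / 2))\<^sup>2" for x :: real
        using cos_double_sin[of "x / 2"] by simp
      then show ?thesis by this
    qed
    finally have R: "(r * (cos s - cos t))\<^sup>2 + (r * (sin s - sin t))\<^sup>2 = (2 * r * sin ((t - s) / 2))\<^sup>2"
      by (simp add: power_mult_distrib)
    have "X s \<phi> t = cnj (g s) * g t * cis (r * (cos s - cos t) * cos \<phi> + r * (sin s - sin t) * sin \<phi>)" for \<phi>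
    proof -
      have "cis (r * cos (s - \<phi>)) * cis (- r * cos (t - \<phi>))
          = cis (r * (cos s - cos t) * cos \<phi> + r * (sin s - sin t) * sin \<phi>)"
        unfolding cis_mult by (intro arg_cong[where f = cis]) (simp add: cos_diff algebra_simps)
      then show ?thesis
        by (simp add: X_def mult_ac)
    qed
    then show "(\<integral>\<phi>. X s \<phi> t \<partial>circ) = cnj (g s) * g t * J (t - s)"
      by (simp add: integral_cis_circ[OF R] J_def)
  qed
  also have "\<dots> = (\<integral>s. (\<integral>\<alpha>. cnj (g s) * g (\<alpha> + s) * J \<alpha> \<partial>circ) \<partial>circ)"
  proof (rule Bochner_Integration.integral_cong[OF refl])
    fix s
    \<comment> \<open>A full turn adds only pi to the half angle and flips the sign of the sine, so
      periodicity of J rests on evenness of \<open>bessel_J 0\<close>.\<close>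
    have "J (t + 2 * pi - s) = J (t - s)" for t
    proof -
      have "(t + 2 * pi - s) / 2 = (t - s) / 2 + pi"
        by (simp add: field_simps)
      then show ?thesis
        by (simp only: J_def sin_periodic_pi mult_minus_right bessel_J0_minus)
    qed
    then have "(\<integral>t. cnj (g s) * g (t + s) * J (t + s - s) \<partial>circ) = (\<integral>t. cnj (g s) * g t * J (t - s) \<partial>circ)"
      by (intro integral_circ_shift[of "\<lambda>t. cnj (g s) * g t * J (t - s)"]) (auto simp: periodic)
    then show "(\<integral>t. cnj (g s) * g t * J (t - s) \<partial>circ) = (\<integral>\<alpha>. cnj (g s) * g (\<alpha> + s) * J \<alpha> \<partial>circ)"
      by simp
  qed
  also have "\<dots> = (\<integral>\<alpha>. (\<integral>s. cnj (g s) * g (\<alpha> + s) * J \<alpha> \<partial>circ) \<partial>circ)"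
  \<comment> \<open>After the substitution the majorant
    \<open>cmod (g s) * cmod (g (\<alpha> + s))\<close> is not a function of s times a function of
    \<alpha>. Its integral over \<alpha> is C times \<open>cmod (g s)\<close> by shift invariance,
    and that is integrable in s.\<close>
  proof (rule Fubini_circ[symmetric])
    have bound: "norm (cnj (g s) * g (\<alpha> + s) * J \<alpha>) \<le> cmod (g s) * cmod (g (\<alpha> + s))" for s \<alpha>
      using mult_left_mono[OF J_le[of \<alpha>], of "cmod (g s) * cmod (g (\<alpha> + s))"] by (simp add: norm_mult)
    have int_g: "integrable circ (\<lambda>\<alpha>. cmod (g (\<alpha> + s)))" for s
      by (rule integrable_circ_shift) (auto simp: periodic integrable_norm_g)
    show int: "integrable circ (\<lambda>\<alpha>. cnj (g s) * g (\<alpha> + s) * J \<alpha>)" for s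
    proof (rule Bochner_Integration.integrable_bound)
      show "integrable circ (\<lambda>\<alpha>. cmod (g s) * cmod (g (\<alpha> + s)))"
        using int_g by simp
    qed (use bound in \<open>auto intro!: AE_I2\<close>)
    have "(\<integral>\<alpha>. norm (cnj (g s) * g (\<alpha> + s) * J \<alpha>) \<partial>circ) \<le> cmod (g s) * C" for s
    proof -
      have "(\<integral>\<alpha>. norm (cnj (g s) * g (\<alpha> + s) * J \<alpha>) \<partial>circ) \<le> (\<integral>\<alpha>. cmod (g s) * cmod (g (\<alpha> + s)) \<partial>circ)"
        using int bound int_g by (intro integral_mono integrable_norm) auto
      also have "(\<integral>\<alpha>. cmod (g (\<alpha> + s)) \<partial>circ) = C"
        unfolding C_def by (rule integral_circ_shift) (auto simp: periodic)
      then have "(\<integral>\<alpha>. cmod (g s) * cmod (g (\<alpha> + s)) \<partial>circ) = cmod (g s) * C"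
        by simp
      finally show ?thesis .
    qed
    moreover have "0 \<le> (\<integral>\<alpha>. norm (cnj (g s) * g (\<alpha> + s) * J \<alpha>) \<partial>circ)" for s
      by (rule Bochner_Integration.integral_nonneg) simp
    ultimately have le: "norm (\<integral>\<alpha>. norm (cnj (g s) * g (\<alpha> + s) * J \<alpha>) \<partial>circ) \<le> norm (cmod (g s) * C)" for s
      by (metis abs_of_nonneg order_trans real_norm_def)
    show "integrable circ (\<lambda>s. \<integral>\<alpha>. norm (cnj (g s) * g (\<alpha> + s) * J \<alpha>) \<partial>circ)"
    proof (rule Bochner_Integration.integrable_bound)
      show "integrable circ (\<lambda>s. cmod (g s) * C)"
        using integrable_norm_g by simp
    qed (use le in \<open>auto intro!: AE_I2\<close>)
  qed measurable
  also have "\<dots> = (\<integral>\<alpha>. (\<integral>s. g (s + \<alpha>) * cnj (g s) \<partial>circ) * J \<alpha> \<partial>circ)"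
    by (simp add: add.commute mult.commute[of "cnj _"])
  \<comment> \<open>The left-hand side is real, so taking real parts on the right loses nothing and
    turns the complex autocorrelation into \<open>correlation\<close>.\<close>
  finally have "(\<integral>\<phi>. (cmod (amplitude r \<phi>))\<^sup>2 \<partial>circ) = Re (\<integral>\<alpha>. (\<integral>s. g (s + \<alpha>) * cnj (g s) \<partial>circ) * J \<alpha> \<partial>circ)"
    by (metis Re_complex_of_real)
  also have "\<dots> = (\<integral>\<alpha>. Re ((\<integral>s. g (s + \<alpha>) * cnj (g s) \<partial>circ) * J \<alpha>) \<partial>circ)"
  proof (rule integral_Re[symmetric])
    have "cmod (\<integral>s. g (s + \<alpha>) * cnj (g s) \<partial>circ) \<le> energy" for \<alpha>
    proof -
      have "cmod (\<integral>s. g (s + \<alpha>) * cnj (g s) \<partial>circ) \<le> (\<integral>s. cmod (g (s + \<alpha>) * cnj (g s)) \<partial>circ)"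
        by (rule integral_norm_bound)
      also have "\<dots> \<le> (\<integral>s. ((cmod (g (s + \<alpha>)))\<^sup>2 + (cmod (g s))\<^sup>2) / 2 \<partial>circ)"
        using norm_mult_le square_integrable_shift square_integrable
        by (intro integral_mono integrable_norm integrable_correlation) auto
      also have "\<dots> = energy"
        using square_integrable_shift square_integrable by (simp add: energy_shift flip: energy_def)
      finally show ?thesis .
    qed
    then show "integrable circ (\<lambda>\<alpha>. (\<integral>s. g (s + \<alpha>) * cnj (g s) \<partial>circ) * J \<alpha>)"
      using J_le energy_nonneg
      by (intro integrable_circ_bounded[where B = "energy * 1"])
         (auto simp only: norm_mult intro!: mult_mono, auto)
  qed
  also have "\<dots> = angular_mean correlation r"
    unfolding angular_mean_def correlation_def J_def by simp
  finally show ?thesis .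
qed

end

section \<open>The case of equality\<close>

lemma AE_interval_exists:
  fixes d :: real
  assumes "AE r in lborel. 0 < r \<longrightarrow> r < d \<longrightarrow> P r" and "0 < d"
  obtains r where "0 < r" "r < d" "P r"
proof -
  have "\<exists>r. 0 < r \<and> r < d \<and> P r"
  proof (rule ccontr)
    assume "\<not> ?thesis"
    then have "AE r in lborel. r \<notin> {0<..<d}"
      using assms(1) by (auto elim: eventually_mono)
    then have "emeasure lborel {x. 0 < x \<and> x < d} = 0"
      by (subst (asm) AE_iff_measurable[OF _ refl]) auto
    moreover have "{x. 0 < x \<and> x < d} = {0<..<d}"
      by auto
    ultimately show False
      using \<open>0 < d\<close> by simp
  qed
  then show ?thesis
    using that by blast
qed

lemma bessel_J0_nonzero_near_0: obtains d where "d > 0" "\<And>r. 0 < r \<Longrightarrow> r < d \<Longrightarrow> bessel_J 0 r \<noteq> 0"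
proof -
  have "isCont (bessel_J 0) 0"
    using bessel_J0_continuous[of UNIV] by (simp add: continuous_on_eq_continuous_at)
  then obtain d where "d > 0" and d: "\<And>r. dist r 0 < d \<Longrightarrow> dist (bessel_J 0 r) (bessel_J 0 0) < 1"
    unfolding continuous_at_eps_delta by (metis zero_less_one)
  have "bessel_J 0 r \<noteq> 0" if "0 < r" "r < d" for r
    using d[of r] that by (auto simp: dist_real_def)
  with \<open>d > 0\<close> show ?thesis
    using that by blast
qed

lemma I000_pos: "0 < I000"
proof -
  have nonneg: "0 \<le> indicator {0..} r * (r * bessel_J 0 r ^ 6)" for r :: real
    by (simp split: split_indicator add: zero_le_even_power)
  have "I000 \<noteq> 0"
  proof
    assume "I000 = 0"
    then have "(\<integral>\<^sup>+r. ennreal (indicator {0..} r * (r * bessel_J 0 r ^ 6)) \<partial>lborel) = 0"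
      by (simp add: nn_integral_J0_power6)
    then have AE: "AE r in lborel. ennreal (indicator {0..} r * (r * bessel_J 0 r ^ 6)) = 0"
      by (subst (asm) nn_integral_0_iff_AE) simp_all
    obtain d where "d > 0" and d: "\<And>r. 0 < r \<Longrightarrow> r < d \<Longrightarrow> bessel_J 0 r \<noteq> 0"
      by (rule bessel_J0_nonzero_near_0) (rule that)
    have "AE r in lborel. 0 < r \<longrightarrow> r < d \<longrightarrow> bessel_J 0 r = 0"
      using AE
    proof (rule eventually_mono, intro impI)
      fix r :: real
      assume *: "ennreal (indicator {0..} r * (r * bessel_J 0 r ^ 6)) = 0" and r: "0 < r"
      then have "indicator {0..} r * (r * bessel_J 0 r ^ 6) = 0"
        using nonneg[of r] by (simp only: ennreal_eq_0_iff antisym)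
      with r show "bessel_J 0 r = 0"
        by simp
    qed
    then obtain r where "0 < r" "r < d" "bessel_J 0 r = 0"
      using \<open>d > 0\<close> by (rule AE_interval_exists) (rule that)
    with d show False
      by blast
  qed
  moreover have "0 \<le> I000"
    unfolding I000_def set_lebesgue_integral_def
    using nonneg by (intro Bochner_Integration.integral_nonneg) (simp add: mult.commute)
  ultimately show ?thesis by simp
qed

text \<open>The kernel tends to 1 as r tends to 0. In this way information about angular means at
  small radii becomes information about the plain mean of the weight.\<close>

lemma angular_mean_tendsto_0:
  assumes a: "bounded_measurable a" and r: "r \<longlonglongrightarrow> 0"
  shows "(\<lambda>n. angular_mean a (r n)) \<longlonglongrightarrow> (\<integral>\<alpha>. a \<alpha> \<partial>circ)"
proof -
  obtain B where B: "\<And>x. \<bar>a x\<bar> \<le> B" and [measurable]: "a \<in> borel_measurable borel"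
    using a by (auto simp: bounded_measurable_def)
  have "(\<lambda>n. \<integral>\<alpha>. a \<alpha> * bessel_J 0 (2 * r n * sin (\<alpha> / 2)) \<partial>circ) \<longlonglongrightarrow> (\<integral>\<alpha>. a \<alpha> \<partial>circ)"
  proof (rule integral_dominated_convergence[where w = "\<lambda>_. B"])
    show "AE \<alpha> in circ. (\<lambda>n. a \<alpha> * bessel_J 0 (2 * r n * sin (\<alpha> / 2))) \<longlonglongrightarrow> a \<alpha>"
    proof (rule AE_I2)
      fix \<alpha>
      have "(\<lambda>n. 2 * r n * sin (\<alpha> / 2)) \<longlonglongrightarrow> 2 * 0 * sin (\<alpha> / 2)"
        by (intro tendsto_intros r)
      then have "(\<lambda>n. 2 * r n * sin (\<alpha> / 2)) \<longlonglongrightarrow> 0"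
        by simp
      moreover have "isCont (bessel_J 0) 0"
        using bessel_J0_continuous[of UNIV] by (simp add: continuous_on_eq_continuous_at)
      ultimately have "(\<lambda>n. bessel_J 0 (2 * r n * sin (\<alpha> / 2))) \<longlonglongrightarrow> bessel_J 0 0"
        by (rule isCont_tendsto_compose[rotated])
      then show "(\<lambda>n. a \<alpha> * bessel_J 0 (2 * r n * sin (\<alpha> / 2))) \<longlonglongrightarrow> a \<alpha>"
        using tendsto_mult_left by fastforce
    qed
    show "AE \<alpha> in circ. norm (a \<alpha> * bessel_J 0 (2 * r n * sin (\<alpha> / 2))) \<le> B" for n
    proof (rule AE_I2)
      fix \<alpha>
      show "norm (a \<alpha> * bessel_J 0 (2 * r n * sin (\<alpha> / 2))) \<le> B"
        using mult_mono[OF B[of \<alpha>] abs_bessel_J0_le[of "2 * r n * sin (\<alpha> / 2)"]] B[of \<alpha>]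
        by (simp add: abs_mult)
    qed
  qed auto
  then show ?thesis
    by (simp add: angular_mean_def)
qed

text \<open>Equality leaves no room for the deficit, so h vanishes almost everywhere on a right
  neighbourhood of 0 where \<open>bessel_J 0\<close> has no zero. Letting r tend to 0 along zeros of
  h shows that k has mean zero; as k is nonnegative, it vanishes almost everywhere.\<close>

lemma AE_square_eq_1_of_equality:
  fixes u :: "real \<Rightarrow> real"
  assumes u [measurable]: "u \<in> borel_measurable borel" and u_le: "\<And>\<alpha>. \<bar>u \<alpha>\<bar> \<le> 1"
    and q_nonneg: "\<And>r. 0 \<le> angular_mean u r"
    and equality: "(\<integral>\<^sup>+r. ennreal (indicator {0..} r * (r * angular_mean u r ^ 3)) \<partial>lborel) = ennreal I000"
  shows "AE \<alpha> in circ. (u \<alpha>)\<^sup>2 = 1"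
proof -
  define k where "k \<alpha> = (1 - (u \<alpha>)\<^sup>2) / 2" for \<alpha>
  define h where "h = angular_mean k"
  have bu: "bounded_measurable u"
    using u_le by (auto simp: bounded_measurable_def)
  have bk: "bounded_measurable k"
    using bounded_measurable_mult[OF bounded_measurable_const[of "1 / 2"]
        bounded_measurable_diff[OF bounded_measurable_const[of 1] bounded_measurable_power[OF bu, of 2]]]
    by (simp add: k_def[abs_def])
  have [measurable]: "angular_mean u \<in> borel_measurable borel" "h \<in> borel_measurable borel"
    using bounded_measurable_angular_mean[OF bu] bounded_measurable_angular_mean[OF bk]
    by (auto simp: bounded_measurable_def h_def)
  have "ennreal I000 + (\<integral>\<^sup>+r. ennreal (indicator {0..} r * (r * (3 / 4 * (h r)\<^sup>2 * (bessel_J 0 r)\<^sup>2))) \<partial>lborel)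
      = (\<integral>\<^sup>+r. ennreal (indicator {0..} r * (r * angular_mean u r ^ 3))
          + ennreal (indicator {0..} r * (r * (3 / 4 * (h r)\<^sup>2 * (bessel_J 0 r)\<^sup>2))) \<partial>lborel)"
    unfolding equality[symmetric] by (rule nn_integral_add[symmetric]) auto
  also have "\<dots> = (\<integral>\<^sup>+r. ennreal (indicator {0..} r *
      (r * (angular_mean u r ^ 3 + 3 / 4 * (h r)\<^sup>2 * (bessel_J 0 r)\<^sup>2))) \<partial>lborel)"
    using q_nonneg
    by (intro nn_integral_cong) (auto split: split_indicator simp: distrib_left simp flip: ennreal_plus)
  also have "\<dots> \<le> ennreal I000"
    unfolding h_def k_def[abs_def] by (rule radial_cube_deficit[OF u u_le q_nonneg])
  \<comment> \<open>Cancellation is legitimate because \<open>ennreal I000\<close> is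
    finite.\<close>
  finally have "(\<integral>\<^sup>+r. ennreal (indicator {0..} r * (r * (3 / 4 * (h r)\<^sup>2 * (bessel_J 0 r)\<^sup>2))) \<partial>lborel) = 0"
    using ennreal_add_left_cancel_le[of "ennreal I000" _ 0] by simp
  then have AE0: "AE r in lborel. ennreal (indicator {0..} r * (r * (3 / 4 * (h r)\<^sup>2 * (bessel_J 0 r)\<^sup>2))) = 0"
    by (subst (asm) nn_integral_0_iff_AE) auto
  obtain d where "d > 0" and d: "\<And>r. 0 < r \<Longrightarrow> r < d \<Longrightarrow> bessel_J 0 r \<noteq> 0"
    by (rule bessel_J0_nonzero_near_0) (rule that)
  have AE: "AE r in lborel. 0 < r \<longrightarrow> r < d \<longrightarrow> h r = 0"
    using AE0
  proof (rule eventually_mono, intro impI)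
    fix r :: real
    assume *: "ennreal (indicator {0..} r * (r * (3 / 4 * (h r)\<^sup>2 * (bessel_J 0 r)\<^sup>2))) = 0"
      and r: "0 < r" "r < d"
    have "r * (3 / 4 * (h r)\<^sup>2 * (bessel_J 0 r)\<^sup>2) \<le> 0"
      using * r by (simp only: ennreal_eq_0_iff) simp
    moreover have "0 < r * (3 / 4 * (h r)\<^sup>2 * (bessel_J 0 r)\<^sup>2)" if "h r \<noteq> 0"
      using that r d[of r] by simp
    ultimately show "h r = 0"
      by force
  qed
  \<comment> \<open>Vanishing is known only for almost every r, hence zeros of h are selected in
    intervals shrinking to 0.\<close>
  have "\<exists>r. 0 < r \<and> r < d / real (Suc n) \<and> h r = 0" for n
  proof -
    have "d / real (Suc n) \<le> d"
      using \<open>d > 0\<close> by (simp add: divide_simps)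
    then have "AE r in lborel. 0 < r \<longrightarrow> r < d / real (Suc n) \<longrightarrow> h r = 0"
      using AE by (auto elim: eventually_mono)
    moreover have "0 < d / real (Suc n)"
      using \<open>d > 0\<close> by simp
    ultimately show ?thesis
      by (rule AE_interval_exists) blast
  qed
  then obtain r where r: "\<And>n. 0 < r n" "\<And>n. r n < d / real (Suc n)" "\<And>n. h (r n) = 0"
    by metis
  have "(\<lambda>n. d / real (Suc n)) \<longlonglongrightarrow> 0"
    by (rule LIMSEQ_Suc[OF lim_const_over_n])
  then have "r \<longlonglongrightarrow> 0"
    by (rule tendsto_sandwich[OF _ _ tendsto_const, rotated 2])
       (auto intro!: always_eventually less_imp_le r simp del: of_nat_Suc)
  then have "(\<lambda>n. h (r n)) \<longlonglongrightarrow> (\<integral>\<alpha>. k \<alpha> \<partial>circ)"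
    unfolding h_def by (rule angular_mean_tendsto_0[OF bk])
  then have "(\<integral>\<alpha>. k \<alpha> \<partial>circ) = 0"
    using LIMSEQ_unique[OF _ tendsto_const[of 0]] by (simp add: r)
  moreover have "0 \<le> k \<alpha>" for \<alpha>
    using u_le[of \<alpha>] by (simp add: k_def abs_square_le_1)
  moreover have "integrable circ k"
    by (intro integrable_bounded_measurable circ.finite_measure_axioms bk) simp
  ultimately have "AE \<alpha> in circ. k \<alpha> = 0"
    by (subst (asm) integral_nonneg_eq_0_iff_AE) auto
  then show ?thesis
    by eventually_elim (simp add: k_def)
qed

section \<open>Shifts that preserve the function up to sign\<close>

context periodic_L2
begin

lemma angular_mean_correlation_nonneg: "0 \<le> angular_mean correlation r"
  unfolding integral_norm_amplitude_square[symmetric]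
  by (rule Bochner_Integration.integral_nonneg) simp

text \<open>For zero energy the quotient is 0 by the convention on division. The bound by 1 and the
  sign of the angular mean persist, so the inequality needs no case for functions vanishing almost
  everywhere.\<close>

definition normalized_correlation :: "real \<Rightarrow> real" where
  "normalized_correlation \<alpha> = correlation \<alpha> / energy"

lemma normalized_correlation_measurable [measurable]: "normalized_correlation \<in> borel_measurable borel"
  unfolding normalized_correlation_def by measurable

lemma abs_normalized_correlation_le: "\<bar>normalized_correlation \<alpha>\<bar> \<le> 1"
  using abs_correlation_le[of \<alpha>] energy_nonneg
  by (cases "energy = 0") (auto simp: normalized_correlation_def abs_divide divide_le_eq)

lemma angular_mean_correlation_eq: "angular_mean correlation r = energy * angular_mean normalized_correlation r"
proof (cases "energy = 0")
  case True
  then have "correlation \<alpha> = 0" for \<alpha>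
    using abs_correlation_le[of \<alpha>] by simp
  with True show ?thesis
    by (simp add: angular_mean_def)
next
  case False
  then have "correlation \<alpha> = energy * normalized_correlation \<alpha>" for \<alpha>
    by (simp add: normalized_correlation_def)
  then show ?thesis
    by (simp add: angular_mean_def mult.assoc)
qed

lemma angular_mean_normalized_correlation_nonneg: "0 \<le> angular_mean normalized_correlation r"
proof (cases "energy = 0")
  case True
  then show ?thesis
    by (simp add: angular_mean_def normalized_correlation_def)
next
  case False
  then have "0 < energy"
    using energy_nonneg by simp
  then show ?thesis
    using angular_mean_correlation_nonneg[of r] by (simp add: angular_mean_correlation_eq zero_le_mult_iff)
qed

lemma AE_shift_eq:
  assumes "correlation \<alpha> = energy"
  shows "AE s in circ. g (s + \<alpha>) = g s"
proof -
  have "(\<integral>s. (cmod (g (s + \<alpha>) - g s))\<^sup>2 \<partial>circ) = 0"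
    using assms by (simp add: integral_norm_diff_square)
  then have "AE s in circ. (cmod (g (s + \<alpha>) - g s))\<^sup>2 = 0"
    by (subst (asm) integral_nonneg_eq_0_iff_AE) (auto simp: integrable_norm_diff_square)
  then show ?thesis
    by eventually_elim simp
qed

lemma AE_shift_eq_uminus:
  assumes "correlation \<alpha> = - energy"
  shows "AE s in circ. g (s + \<alpha>) = - g s"
proof -
  have "(\<integral>s. (cmod (g (s + \<alpha>) + g s))\<^sup>2 \<partial>circ) = 0"
    using assms by (simp add: integral_norm_sum_square)
  then have "AE s in circ. (cmod (g (s + \<alpha>) + g s))\<^sup>2 = 0"
    by (subst (asm) integral_nonneg_eq_0_iff_AE) (auto simp: integrable_norm_sum_square)
  then show ?thesis
    by eventually_elim (simp add: eq_neg_iff_add_eq_0)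
qed

text \<open>A sign change under the shift by \<open>\<alpha> / 2\<close> is undone by applying this shift twice.\<close>

lemma AE_const_of_normalized_correlation:
  assumes energy: "energy \<noteq> 0" and AE: "AE \<alpha> in circ. (normalized_correlation \<alpha>)\<^sup>2 = 1"
  obtains c where "AE t in circ. g t = c"
proof -
  interpret pair_sigma_finite circ circ by (rule circ_pair_sigma_finite)
  have "AE \<alpha> in circ. (normalized_correlation (\<alpha> / 2))\<^sup>2 = 1"
    using AE by (intro AE_circ_halve) auto
  then have "AE \<alpha> in circ. AE s in circ. g (s + \<alpha>) = g s"
  proof eventually_elim
    case (elim \<alpha>)
    define \<beta> where "\<beta> = \<alpha> / 2"
    have "normalized_correlation \<beta> = 1 \<or> normalized_correlation \<beta> = -1"
      using elim by (simp add: \<beta>_def power2_eq_1_iff)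
    then have "correlation \<beta> = energy \<or> correlation \<beta> = - energy"
      using energy by (simp add: normalized_correlation_def divide_eq_eq)
    \<comment> \<open>The alternatives g and - g are treated together: \<sigma> is 1 or -1, and only
      its square matters after the second shift.\<close>
    then obtain \<sigma> :: complex where \<sigma>: "\<sigma> * \<sigma> = 1" "AE s in circ. g (s + \<beta>) = \<sigma> * g s"
      using AE_shift_eq AE_shift_eq_uminus
      by (metis (no_types, lifting) AE_cong minus_mult_minus mult_1 mult_minus1)
    have "AE s in circ. g (s + \<beta> + \<beta>) = \<sigma> * g (s + \<beta>)"
      using \<sigma>(2) periodic
      by (subst AE_circ_shift[where P = "\<lambda>s. g (s + \<beta>) = \<sigma> * g s"])
         (auto simp: add.commute[of _ \<beta>] add.assoc[symmetric])
    with \<sigma>(2) have "AE s in circ. g (s + \<beta> + \<beta>) = g s"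
    proof eventually_elim
      case (elim s)
      then show ?case
        using \<sigma>(1) by (simp add: mult.assoc[symmetric])
    qed
    then show "AE s in circ. g (s + \<alpha>) = g s"
      by (simp add: \<beta>_def add.assoc)
  qed
  \<comment> \<open>Exchanging the quantifiers yields one base point s for which almost every
    \<alpha> satisfies the equation; g s is then the constant, and shifting back by s removes the
    base point.\<close>
  then have "AE s in circ. AE \<alpha> in circ. g (s + \<alpha>) = g s"
    by (rule AE_commute[THEN iffD1, rotated]) measurable
  then obtain s where "AE \<alpha> in circ. g (s + \<alpha>) = g s"
    using circ.AE_False by (metis (mono_tags, lifting) eventually_mono)
  then have "AE \<alpha> in circ. g (\<alpha> + s) = g s"
    by (simp add: add.commute)
  then have "AE t in circ. g t = g s"
    by (subst (asm) AE_circ_shift[where P = "\<lambda>t. g t = g s"]) (auto simp: periodic)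
  then show ?thesis
    by (rule that)
qed

end

section \<open>The extension inequality\<close>

lemma finite_measure_arc_length: "finite_measure arc_length"
  by (rule finite_measureI) (simp add: space_arc_length emeasure_arc_length)

lemma inner_circle_point: "circle_point s \<bullet> circle_point t = cos (t - s)"
  by (simp add: circle_point_def inner_vec_def sum_2 cos_diff mult.commute)

lemma extension_measurable [measurable]:
  assumes [measurable]: "f \<in> borel_measurable arc_length"
  shows "extension f \<in> borel_measurable borel"
proof -
  interpret finite_measure arc_length by (rule finite_measure_arc_length)
  have [measurable]: "(\<lambda>\<omega>. \<omega>) \<in> measurable arc_length borel"
    by (simp add: measurable_cong_sets[OF sets_arc_length refl] measurable_restrict_space1)
  show ?thesis
    unfolding extension_def by measurable
qed

locale circle_L2 =
  fixes f :: "plane \<Rightarrow> complex"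
  assumes f: "f \<in> L2_circle"
begin

lemma f_measurable [measurable]: "f \<in> borel_measurable arc_length"
  using f by (simp add: L2_circle_def)

lemma f_circle_point_measurable [measurable]: "(\<lambda>t. f (circle_point t)) \<in> borel_measurable borel"
  by (rule measurable_arc_length_compose) measurable

sublocale periodic_L2 "\<lambda>t. f (circle_point t)"
proof
  have "integrable arc_length (\<lambda>\<omega>. (cmod (f \<omega>))\<^sup>2)"
    using f by (simp add: L2_circle_def)
  then show "integrable circ (\<lambda>t. (cmod (f (circle_point t)))\<^sup>2)"
    by (subst (asm) integrable_arc_length) auto
qed (simp_all add: circle_point_periodic)

lemma L2_circle_norm_power: "L2_circle_norm f ^ 6 = (2 * pi * energy) ^ 3"
proof -
  have "(\<integral>\<omega>. (cmod (f \<omega>))\<^sup>2 \<partial>arc_length) = 2 * pi * energy"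
    by (subst integral_arc_length) (auto simp: energy_def)
  then have "(L2_circle_norm f)\<^sup>2 = 2 * pi * energy"
    using energy_nonneg by (simp add: L2_circle_norm_def)
  moreover have "L2_circle_norm f ^ 6 = ((L2_circle_norm f)\<^sup>2) ^ 3"
    by (simp flip: power_mult)
  ultimately show ?thesis
    by simp
qed

text \<open>The factor 1 / (2 pi) of \<open>extension\<close> cancels the total mass of arc length,
  so no constant appears.\<close>

lemma extension_eq_amplitude: "extension f (r *\<^sub>R circle_point \<phi>) = amplitude r \<phi>"
proof -
  have [measurable]: "(\<lambda>\<omega>. \<omega>) \<in> measurable arc_length borel"
    by (simp add: measurable_cong_sets[OF sets_arc_length refl] measurable_restrict_space1)
  have "(\<integral>\<omega>. f \<omega> * exp (- \<i> * complex_of_real ((r *\<^sub>R circle_point \<phi>) \<bullet> \<omega>)) \<partial>arc_length)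
      = (2 * pi) *\<^sub>R (\<integral>t. f (circle_point t) * exp (- \<i> * complex_of_real ((r *\<^sub>R circle_point \<phi>) \<bullet> circle_point t)) \<partial>circ)"
    by (rule integral_arc_length) measurable
  also have "(\<integral>t. f (circle_point t) * exp (- \<i> * complex_of_real ((r *\<^sub>R circle_point \<phi>) \<bullet> circle_point t)) \<partial>circ)
      = amplitude r \<phi>"
    by (simp add: amplitude_def inner_circle_point cis_conv_exp)
  finally show ?thesis
    by (simp add: extension_def scaleR_conv_of_real)
qed

lemma nn_integral_extension:
  "(\<integral>\<^sup>+\<omega>. ennreal ((cmod (extension f (r *\<^sub>R \<omega>)))\<^sup>2) \<partial>arc_length)
    = ennreal (2 * pi * energy * angular_mean normalized_correlation r)"
proof -
  have [measurable]: "(\<lambda>\<omega>. \<omega>) \<in> measurable arc_length borel"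
    by (simp add: measurable_cong_sets[OF sets_arc_length refl] measurable_restrict_space1)
  define C where "C = (\<integral>t. cmod (f (circle_point t)) \<partial>circ)"
  have "(\<integral>\<^sup>+\<omega>. ennreal ((cmod (extension f (r *\<^sub>R \<omega>)))\<^sup>2) \<partial>arc_length)
      = ennreal (2 * pi) * (\<integral>\<^sup>+\<phi>. ennreal ((cmod (extension f (r *\<^sub>R circle_point \<phi>)))\<^sup>2) \<partial>circ)"
    by (rule nn_integral_arc_length) measurable
  also have "\<dots> = ennreal (2 * pi) * (\<integral>\<^sup>+\<phi>. ennreal ((cmod (amplitude r \<phi>))\<^sup>2) \<partial>circ)"
    by (simp add: extension_eq_amplitude)
  also have "(\<integral>\<^sup>+\<phi>. ennreal ((cmod (amplitude r \<phi>))\<^sup>2) \<partial>circ) = ennreal (\<integral>\<phi>. (cmod (amplitude r \<phi>))\<^sup>2 \<partial>circ)"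
  proof (rule nn_integral_eq_integral)
    have "norm ((cmod (amplitude r \<phi>))\<^sup>2) \<le> C\<^sup>2" for \<phi>
      using norm_amplitude_le[of r \<phi>] by (simp add: C_def power_mono)
    then show "integrable circ (\<lambda>\<phi>. (cmod (amplitude r \<phi>))\<^sup>2)"
      by (rule integrable_circ_bounded[rotated]) measurable
  qed simp
  also have "\<dots> = ennreal (energy * angular_mean normalized_correlation r)"
    by (simp add: integral_norm_amplitude_square angular_mean_correlation_eq)
  finally show ?thesis
    by (simp add: ennreal_mult'[symmetric] mult.assoc)
qed

text \<open>The prefactor is the sixth power of the norm of f, as in \<open>bound_eq\<close>. The
  inequality and its equality case thus concern only a radial integral of the normalized
  correlation, which does not depend on the size of f.\<close>

lemma mixed_norm_extension_power:
  "mixed_norm (extension f) ^ 6 = ennreal ((2 * pi * energy) ^ 3) *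
    (\<integral>\<^sup>+r. ennreal (indicator {0..} r * (r * angular_mean normalized_correlation r ^ 3)) \<partial>lborel)"
proof -
  have bu: "bounded_measurable normalized_correlation"
    using abs_normalized_correlation_le by (auto simp: bounded_measurable_def)
  have [measurable]: "angular_mean normalized_correlation \<in> borel_measurable borel"
    using bounded_measurable_angular_mean[OF bu] by (auto simp: bounded_measurable_def)
  have "mixed_norm (extension f) ^ 6
      = (\<integral>\<^sup>+r\<in>{0..}. ennreal (2 * pi * energy * angular_mean normalized_correlation r) ^ 3 * ennreal r \<partial>lborel)"
    by (simp add: mixed_norm_def ennreal_root_power nn_integral_extension)
  also have "\<dots> = (\<integral>\<^sup>+r. ennreal ((2 * pi * energy) ^ 3) *
      ennreal (indicator {0..} r * (r * angular_mean normalized_correlation r ^ 3)) \<partial>lborel)"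
  proof (rule nn_integral_cong)
    fix r :: real
    show "ennreal (2 * pi * energy * angular_mean normalized_correlation r) ^ 3 * ennreal r * indicator {0..} r
        = ennreal ((2 * pi * energy) ^ 3) * ennreal (indicator {0..} r * (r * angular_mean normalized_correlation r ^ 3))"
    proof (cases "0 \<le> r")
      case True
      have nonneg: "0 \<le> 2 * pi * energy * angular_mean normalized_correlation r"
        using energy_nonneg angular_mean_normalized_correlation_nonneg[of r] by simp
      have "ennreal (2 * pi * energy * angular_mean normalized_correlation r) ^ 3 * ennreal r
          = ennreal ((2 * pi * energy * angular_mean normalized_correlation r) ^ 3 * r)"
        by (simp only: ennreal_power[OF nonneg] ennreal_mult[OF zero_le_power[OF nonneg] True])
      also have "(2 * pi * energy * angular_mean normalized_correlation r) ^ 3 * r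
          = (2 * pi * energy) ^ 3 * (r * angular_mean normalized_correlation r ^ 3)"
        by (simp only: power_mult_distrib mult_ac)
      also have "ennreal \<dots> = ennreal ((2 * pi * energy) ^ 3) * ennreal (r * angular_mean normalized_correlation r ^ 3)"
        using energy_nonneg by (intro ennreal_mult') simp
      finally show ?thesis
        using True by simp
    qed simp
  qed
  also have "\<dots> = ennreal ((2 * pi * energy) ^ 3) *
      (\<integral>\<^sup>+r. ennreal (indicator {0..} r * (r * angular_mean normalized_correlation r ^ 3)) \<partial>lborel)"
    by (rule nn_integral_cmult) measurable
  finally show ?thesis .
qed

lemma radial_integral_le:
  "(\<integral>\<^sup>+r. ennreal (indicator {0..} r * (r * angular_mean normalized_correlation r ^ 3)) \<partial>lborel) \<le> ennreal I000"
proof -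
  let ?h = "angular_mean (\<lambda>\<alpha>. (1 - (normalized_correlation \<alpha>)\<^sup>2) / 2)"
  have "(\<integral>\<^sup>+r. ennreal (indicator {0..} r * (r * angular_mean normalized_correlation r ^ 3)) \<partial>lborel)
      \<le> (\<integral>\<^sup>+r. ennreal (indicator {0..} r * (r * (angular_mean normalized_correlation r ^ 3
          + 3 / 4 * (?h r)\<^sup>2 * (bessel_J 0 r)\<^sup>2))) \<partial>lborel)"
    by (intro nn_integral_mono ennreal_leI) (auto split: split_indicator intro!: mult_left_mono)
  also have "\<dots> \<le> ennreal I000"
    by (intro radial_cube_deficit normalized_correlation_measurable abs_normalized_correlation_le
        angular_mean_normalized_correlation_nonneg)
  finally show ?thesis .
qed

lemma bound_eq: "ennreal (C * L2_circle_norm f ^ 6) = ennreal ((2 * pi * energy) ^ 3) * ennreal C"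
proof -
  have "0 \<le> (2 * pi * energy) ^ 3"
    using energy_nonneg by simp
  then show ?thesis
    by (simp add: L2_circle_norm_power mult.commute[of C] ennreal_mult')
qed

lemma mixed_norm_extension_le:
  "mixed_norm (extension f) ^ 6 \<le> ennreal (I000 * L2_circle_norm f ^ 6)"
  unfolding bound_eq mixed_norm_extension_power by (intro mult_left_mono radial_integral_le) simp

lemma energy_eq_0_iff: "energy = 0 \<longleftrightarrow> (AE \<omega> in arc_length. f \<omega> = 0)"
proof -
  have "energy = 0 \<longleftrightarrow> (AE t in circ. (cmod (f (circle_point t)))\<^sup>2 = 0)"
    unfolding energy_def by (rule integral_nonneg_eq_0_iff_AE) (auto simp: square_integrable)
  also have "\<dots> \<longleftrightarrow> (AE \<omega> in arc_length. f \<omega> = 0)"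
    by (subst AE_arc_length_iff) auto
  finally show ?thesis .
qed

lemma extremizer_imp_AE_const:
  assumes "extremizer f"
  obtains c where "c \<noteq> 0" "AE \<omega> in arc_length. f \<omega> = c"
proof -
  have energy: "0 < energy"
    using assms energy_eq_0_iff energy_nonneg by (auto simp: extremizer_def)
  then have pos: "0 < (2 * pi * energy) ^ 3"
    by simp
  have "ennreal ((2 * pi * energy) ^ 3) *
      (\<integral>\<^sup>+r. ennreal (indicator {0..} r * (r * angular_mean normalized_correlation r ^ 3)) \<partial>lborel)
      = ennreal ((2 * pi * energy) ^ 3) * ennreal I000"
    using assms unfolding extremizer_def bound_eq mixed_norm_extension_power by blast
  then have "(\<integral>\<^sup>+r. ennreal (indicator {0..} r * (r * angular_mean normalized_correlation r ^ 3)) \<partial>lborel) = ennreal I000"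
    using pos by (subst (asm) ennreal_mult_cancel_left) (auto simp: ennreal_eq_0_iff)
  then have "AE \<alpha> in circ. (normalized_correlation \<alpha>)\<^sup>2 = 1"
    by (intro AE_square_eq_1_of_equality normalized_correlation_measurable
        abs_normalized_correlation_le angular_mean_normalized_correlation_nonneg)
  then obtain c where "AE t in circ. f (circle_point t) = c"
    using energy by (elim AE_const_of_normalized_correlation[rotated]) auto
  then have c: "AE \<omega> in arc_length. f \<omega> = c"
    by (subst AE_arc_length_iff) auto
  moreover have "c \<noteq> 0"
    using c assms by (auto simp: extremizer_def)
  ultimately show ?thesis
    using that by blast
qed

text \<open>Shifts preserve null sets, so the normalized correlation is 1 at every \<alpha>,
  although f is constant only almost everywhere. Its angular mean is then the square of
  \<open>bessel_J 0\<close>, and the radial integral is exactly \<open>I000\<close>.\<close>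

lemma AE_const_imp_extremizer:
  assumes "c \<noteq> 0" "AE \<omega> in arc_length. f \<omega> = c"
  shows "extremizer f"
proof -
  have AE: "AE t in circ. f (circle_point t) = c"
    using assms(2) by (subst (asm) AE_arc_length_iff) auto
  have "energy = (\<integral>t. (cmod c)\<^sup>2 \<partial>circ)"
    unfolding energy_def using AE by (intro integral_cong_AE) (auto elim: eventually_mono)
  then have energy: "energy = (cmod c)\<^sup>2"
    by simp
  have "normalized_correlation \<alpha> = 1" for \<alpha>
  proof -
    have "AE s in circ. f (circle_point (s + \<alpha>)) = c"
      using AE by (subst AE_circ_shift[where P = "\<lambda>t. f (circle_point t) = c"]) (auto simp: circle_point_periodic)
    with AE have "AE s in circ. f (circle_point (s + \<alpha>)) * cnj (f (circle_point s)) = (cmod c)\<^sup>2"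
      by eventually_elim (simp add: complex_norm_square del: of_real_power)
    then have "(\<integral>s. f (circle_point (s + \<alpha>)) * cnj (f (circle_point s)) \<partial>circ) = (\<integral>s. complex_of_real ((cmod c)\<^sup>2) \<partial>circ)"
      by (intro integral_cong_AE) auto
    then show ?thesis
      using assms(1) by (simp add: normalized_correlation_def correlation_def energy del: of_real_power)
  qed
  then have "angular_mean normalized_correlation r = (bessel_J 0 r)\<^sup>2" for r
    using angular_mean_1[of r] by (simp add: angular_mean_def)
  then have "mixed_norm (extension f) ^ 6 = ennreal (I000 * L2_circle_norm f ^ 6)"
    unfolding mixed_norm_extension_power bound_eq by (simp add: nn_integral_J0_power6 flip: power_mult)
  moreover have "\<not> (AE \<omega> in arc_length. f \<omega> = 0)"
    using energy assms(1) by (simp flip: energy_eq_0_iff)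
  ultimately show ?thesis
    using f by (simp add: extremizer_def)
qed

end

section \<open>Sharpness of the constant\<close>

lemma const_in_L2_circle: "(\<lambda>_. c) \<in> L2_circle"
  using finite_measure_arc_length by (simp add: L2_circle_def finite_measure.integrable_const)

text \<open>The constant function 1 attains equality with positive norm. Since
  \<open>ennreal\<close> sends negative reals to 0, a negative C has to be excluded separately;
  positivity of \<open>I000\<close> does this.\<close>

lemma sharp_constant:
  assumes "\<And>f. f \<in> L2_circle \<Longrightarrow> mixed_norm (extension f) ^ 6 \<le> ennreal (C * L2_circle_norm f ^ 6)"
  shows "I000 \<le> C"
proof -
  interpret circle_L2 "\<lambda>_. 1"
    by (rule circle_L2.intro) (rule const_in_L2_circle)
  have "extremizer (\<lambda>_. 1)"
    by (rule AE_const_imp_extremizer[of 1]) auto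
  then have "ennreal (I000 * L2_circle_norm (\<lambda>_. 1) ^ 6) \<le> ennreal (C * L2_circle_norm (\<lambda>_. 1) ^ 6)"
    using assms[OF const_in_L2_circle[of 1]] by (simp add: extremizer_def)
  moreover have "0 < L2_circle_norm (\<lambda>_. 1) ^ 6"
    unfolding L2_circle_norm_power by (simp add: energy_def)
  ultimately show ?thesis
    using I000_pos by (auto simp: ennreal_le_iff2 mult_le_0_iff)
qed

theorem mainTheorem1:
  shows "(\<forall>f \<in> L2_circle.
            mixed_norm (extension f) ^ 6 \<le> ennreal (I000 * L2_circle_norm f ^ 6)) \<and>
         (\<forall>C :: real.
            (\<forall>f \<in> L2_circle. mixed_norm (extension f) ^ 6 \<le> ennreal (C * L2_circle_norm f ^ 6))
            \<longrightarrow> I000 \<le> C) \<and>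
         (\<forall>f. extremizer f \<longleftrightarrow>
            f \<in> L2_circle \<and> (\<exists>c. c \<noteq> 0 \<and> (AE \<omega> in arc_length. f \<omega> = c)))"
proof (intro conjI ballI allI impI)
  show "mixed_norm (extension f) ^ 6 \<le> ennreal (I000 * L2_circle_norm f ^ 6)" if "f \<in> L2_circle" for f
    using that by (intro circle_L2.mixed_norm_extension_le circle_L2.intro)
  show "I000 \<le> C"
    if "\<forall>f \<in> L2_circle. mixed_norm (extension f) ^ 6 \<le> ennreal (C * L2_circle_norm f ^ 6)" for C
    using that by (intro sharp_constant) blast
  show "extremizer f \<longleftrightarrow> f \<in> L2_circle \<and> (\<exists>c. c \<noteq> 0 \<and> (AE \<omega> in arc_length. f \<omega> = c))" for f
  proof (cases "f \<in> L2_circle")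
    case True
    then interpret circle_L2 f by (rule circle_L2.intro)
    show ?thesis
      using True extremizer_imp_AE_const AE_const_imp_extremizer by metis
  qed (simp add: extremizer_def)
qed

end
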